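(* Let $T>0$, $\mathcal{R}=\frac{2\pi}{T}$, $S^1=\mathbb{R}/2\pi\mathbb{Z}$, $\mathbb{T}^2=(\mathbb{R}/T\mathbb{Z})\times(\mathbb{R}/2\pi\mathbb{Z})$ with coordinates $(t,x)$ and $dV=dt\wedge dx$. Let $V_t:S^1\to\mathbb{R}$ be a family of potentials, smooth and $T$-periodic in $t$ and uniformly bounded by a constant, and let $\rho:\mathbb{R}\to\mathbb{R}$ be smooth with support in $(-r,r)$ for some $r<\pi$ (regarded also as a function on $S^1$). For $f:S^1\to\mathbb{R}$ set $(f*\rho)(q)=\int_{S^1}f(x)\rho(q-x)\,dx$. Write $u=(q,p)\in T^*S^1=S^1\times\mathbb{R}$ and $Z=(\varphi,\pi_1,\pi_2,o)\in\mathbb{R}^4$, and let \[ H_t(u,\varphi(\cdot))=\tfrac12p^2+V_t(q)+(\varphi*\rho)(q),\qquad S_{t,x}(u,Z)=\tfrac12\varphi^2+\tfrac12\pi_1^2-\tfrac12\pi_2^2-\tfrac12o^2+\varphi\,\rho(q-x). \] Let $J=\begin{pmatrix}0&-1\\1&0\end{pmatrix}$ and \[ M_1=\begin{pmatrix}0&-1&0&0\\1&0&0&0\\0&0&0&1\\0&0&-1&0\end{pmatrix},\qquad M_2=\begin{pmatrix}0&0&1&0\\0&0&0&-1\\-1&0&0&0\\0&1&0&0\end{pmatrix}. \] Let $\widetilde{F}=(\widetilde{u},\widetilde{Z})$ with $\widetilde{u}=(\widetilde{q},\widetilde{p}):\mathbb{R}\times(\mathbb{R}/T\mathbb{Z})\to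 T^*S^1$ and $\widetilde{Z}:\mathbb{R}\times\mathbb{T}^2\to\mathbb{R}^4$ smooth, solving \[ \partial_s\widetilde{u}(s,t)=-J\partial_t\widetilde{u}(s,t)+\nabla_uH_t\big(\widetilde{u}(s,t),\widetilde{\varphi}(s,t,\cdot)\big), \] \[ \partial_s\widetilde{Z}(s,t,x)=-M_1\partial_t\widetilde{Z}(s,t,x)-M_2\partial_x\widetilde{Z}(s,t,x)+\nabla_ZS_{t,x}\big(\widetilde{u}(s,t),\widetilde{Z}(s,t,x)\big), \] where $\widetilde{\varphi}$ is the first component of $\widetilde{Z}$ and $\nabla_u,\nabla_Z$ are the gradients in the $u$ and $Z$ variables, and having finite energy \[ E(\widetilde{F})=\int_{-\infty}^{+\infty}\left(\int_{\mathbb{R}/T\mathbb{Z}}|\partial_s\widetilde{u}(s,t)|^2\,dt+\int_{\mathbb{T}^2}|\partial_s\widetilde{Z}(s,t,x)|^2\,dV\right)ds<+\infty. \] Assume there exists a smooth $u^+:\mathbb{R}/T\mathbb{Z}\to T^*S^1$ such that $\widetilde{u}_s:=\widetilde{u}(s,\cdot)\to u^+$ and $\partial_s\widetilde{u}_s\to0$ in the $C^\infty$-topology as $s\to+\infty$. If $\mathcal{R}^{-2}=\left(\frac{T}{2\pi}\right)^2$ has irrationality measure equal to $2$, then there exists $Z^+\in C^\infty(\mathbb{T}^2,\mathbb{R}^4)$ such that $\lim_{s\to+\infty}\widetilde{Z}_s=Z^+$ in the $C^\infty$-topology, where $\widetilde{Z}_s=\widetilde{Z}(s,\cdot,\cd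ot)$.
   Context: The irrationality measure of a real number $r$ is the infimum of all $\rho$ for which there exists a constant $c$ such that $\frac{c}{q^\rho}<|r-\frac{p}{q}|$ for all $\frac{p}{q}\in\mathbb{Q}$. *)

theory Defs
  imports "HOL-Analysis.Analysis"
begin

fun Ck :: "nat \<Rightarrow> ('a::euclidean_space \<Rightarrow> 'b::real_normed_vector) \<Rightarrow> bool" where
  "Ck 0 f = continuous_on UNIV f"
| "Ck (Suc k) f = (\<exists>f'. (\<forall>x. (f has_derivative f' x) (at x)) \<and> (\<forall>v. Ck k (\<lambda>x. f' x v)))"

definition smooth :: "('a::euclidean_space \<Rightarrow> 'b::real_normed_vector) \<Rightarrow> bool" where
  "smooth f \<longleftrightarrow> (\<forall>k. Ck k f)"

definition dD :: "(real \<Rightarrow> 'a::real_normed_vector) \<Rightarrow> real \<Rightarrow> 'a" where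
  "dD f = (\<lambda>t. vector_derivative f (at t))"

definition Dtx :: "nat \<Rightarrow> nat \<Rightarrow> (real \<Rightarrow> real \<Rightarrow> 'a::real_normed_vector) \<Rightarrow> real \<Rightarrow> real \<Rightarrow> 'a" where
  "Dtx j k g t x = (dD ^^ j) (\<lambda>t'. (dD ^^ k) (\<lambda>x'. g t' x') x) t"

definition grad :: "(real^'n \<Rightarrow> real) \<Rightarrow> real^'n \<Rightarrow> real^'n" where
  "grad f y = (\<chi> i. deriv (\<lambda>h. f (y + h *\<^sub>R axis i 1)) 0)"

text \<open>rho, supported in (-r,r) with r < pi, regarded as a function on S^1 = R/2piZ:
  its 2pi-periodic extension (reduction to [-pi,pi)).\<close>
definition rho_S1 :: "(real \<Rightarrow> real) \<Rightarrow> real \<Rightarrow> real" where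
  "rho_S1 \<rho> y = \<rho> (y - 2 * pi * of_int \<lfloor>(y + pi) / (2 * pi)\<rfloor>)"

definition conv_S1 :: "(real \<Rightarrow> real) \<Rightarrow> (real \<Rightarrow> real) \<Rightarrow> real \<Rightarrow> real" where
  "conv_S1 f \<rho> q = integral {0..2*pi} (\<lambda>x. f x * rho_S1 \<rho> (q - x))"

text \<open>H_t(u, phi) with u = (q,p) (q a real lift of the S^1 coordinate).\<close>
definition Ham :: "(real \<Rightarrow> real \<Rightarrow> real) \<Rightarrow> (real \<Rightarrow> real) \<Rightarrow> real \<Rightarrow> (real \<Rightarrow> real) \<Rightarrow> real^2 \<Rightarrow> real" where
  "Ham V \<rho> t \<phi> u = (u$2)\<^sup>2 / 2 + V t (u$1) + conv_S1 \<phi> \<rho> (u$1)"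

definition Sfun :: "(real \<Rightarrow> real) \<Rightarrow> real \<Rightarrow> real \<Rightarrow> real^2 \<Rightarrow> real^4 \<Rightarrow> real" where
  "Sfun \<rho> t x u Z = (Z$1)\<^sup>2/2 + (Z$2)\<^sup>2/2 - (Z$3)\<^sup>2/2 - (Z$4)\<^sup>2/2 + Z$1 * rho_S1 \<rho> (u$1 - x)"

definition Jmat :: "real^2^2" where
  "Jmat = vector [vector [0, -1], vector [1, 0]]"

definition M1 :: "real^4^4" where
  "M1 = vector [vector [0, -1, 0, 0], vector [1, 0, 0, 0], vector [0, 0, 0, 1], vector [0, 0, -1, 0]]"

definition M2 :: "real^4^4" where
  "M2 = vector [vector [0, 0, 1, 0], vector [0, 0, 0, -1], vector [-1, 0, 0, 0], vector [0, 1, 0, 0]]"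

definition irrationality_measure :: "real \<Rightarrow> ereal" where
  "irrationality_measure r = Inf {ereal \<rho> | \<rho>. \<exists>c>0. \<forall>(p::int) (q::int). q > 0 \<longrightarrow>
      c / (real_of_int q) powr \<rho> < \<bar>r - real_of_int p / real_of_int q\<bar>}"

end

theory Submission
  imports Defs
begin

text \<open>
  With alpha = phi + i pi_1, gamma = o + i pi_2 and F = rho(q - x), the Z-equation becomes
  d_s alpha = - i d_t alpha + i d_x gamma + alpha + F and
  d_s gamma = - i d_t gamma + i d_x alpha - gamma.
  On the Fourier mode exp(i(mRt + nx)) this is a real symmetric 2x2 system with eigenvalues
  mR + sqrt(1 + n^2) and mR - sqrt(1 + n^2), so each eigencomponent solves y' = l y + g where g(s)
  converges and decays rapidly in (m, n). Since l is nonzero and finite energy rules out exponential growth,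
  y(s) tends to - g(infinity)/l and is bounded by |y(s_0)| + sup |g| / |l|. The irrationality measure
  bounds |l| from below by a negative power of |m| + |n|, because
  (sqrt(1 + n^2) - mR)(sqrt(1 + n^2) + mR) = R^2 (1 + n^2) (R^(-2) - m^2/(1 + n^2)).
  Hence the Fourier coefficients of Z_s converge and decay rapidly uniformly in s, which gives uniform
  convergence of all derivatives.
\<close>

section \<open>Directional derivatives of smooth functions\<close>

text \<open>Once \<open>q\<close> is given, the Z-equation is linear with forcing F. Its operator is
  of wave type: the eigenvalues are nonzero but need not stay away from zero, so no exponential rate
  uniform in the modes is available. Each mode converges at its own rate, and uniformity comes from
  decay in (m, n) alone. Smoothness of \<open>rho\<close> and of the limit curve makes the
  coefficients of F decay faster than any power, which absorbs the polynomial loss from dividing by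
  l. Finite energy is used through arbitrarily late times at which d_s Z has L2 norm at most 1; a
  growing mode would have a large s-derivative at every late time.

  The limit is not assembled as a Fourier series. The Cauchy criterion is checked for every
  derivative and completeness supplies the limit, so the one fact needed from Fourier analysis is a
  bound of the sup norm by weighted coefficients, not an inversion theorem.\<close>

definition pd :: "'a::euclidean_space \<Rightarrow> ('a \<Rightarrow> 'b::real_normed_vector) \<Rightarrow> 'a \<Rightarrow> 'b" where
  "pd v f x = frechet_derivative f (at x) v"

lemma pd_eq: "(f has_derivative f') (at x) \<Longrightarrow> pd v f x = f' v"
  unfolding pd_def using frechet_derivative_at by metis

lemma smooth_has_derivative:
  assumes "smooth f"
  shows "(f has_derivative (\<lambda>v. pd v f x)) (at x)"
proof -
  have "Ck (Suc 0) f" using assms unfolding smooth_def by blast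
  then obtain f' where "(f has_derivative f' x) (at x)" by auto
  then show ?thesis unfolding pd_def using frechet_derivative_at by metis
qed

lemma smooth_pd:
  assumes "smooth f"
  shows "smooth (pd v f)"
  unfolding smooth_def
proof
  fix k
  have "Ck (Suc k) f" using assms unfolding smooth_def by blast
  then obtain f' where f': "\<And>x. (f has_derivative f' x) (at x)" and c: "Ck k (\<lambda>x. f' x v)" by auto
  have "(\<lambda>x. f' x v) = pd v f" using pd_eq[OF f'] by auto
  with c show "Ck k (pd v f)" by simp
qed

lemma smooth_continuous_on: "smooth f \<Longrightarrow> continuous_on S f"
  unfolding smooth_def by (metis Ck.simps(1) continuous_on_subset top_greatest)

text \<open>\<open>Ck\<close> asks at each level merely for some derivative whose directional values
  are again in the class. A property closed under this step is therefore inherited at every order,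
  by induction on \<open>k\<close> for all members at once. No formula for higher derivatives has to
  be written down.\<close>

lemma smooth_coinduct:
  assumes "P f"
    and step: "\<And>g. P g \<Longrightarrow> \<exists>g'. (\<forall>x. (g has_derivative g' x) (at x)) \<and> (\<forall>v. P (\<lambda>x. g' x v))"
  shows "smooth f"
  unfolding smooth_def
proof
  fix k
  show "Ck k f" using \<open>P f\<close>
  proof (induction k arbitrary: f)
    case 0
    then show ?case
      using step[OF 0] has_derivative_continuous
      by (auto simp: continuous_on_eq_continuous_at) blast
  next
    case (Suc k)
    then show ?case using step[OF Suc.prems] by auto
  qed
qed

text \<open>A list \<open>w\<close> of directions is a word for an iterated directional derivative.
  Convergence in C-infinity then means uniform convergence of \<open>foldr pd w\<close> for every
  word.\<close>

lemma smooth_foldr_pd: "smooth f \<Longrightarrow> smooth (foldr pd w f)"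
  by (induction w) (auto intro: smooth_pd)

text \<open>One affine substitution serves two purposes below: freezing \<open>s\<close> (with
  \<open>A\<close> the embedding of the remaining variables and \<open>c = (s, 0)\<close>) and
  passing to components or complex combinations (through \<open>L\<close>).\<close>

lemma has_derivative_affine_comp:
  assumes "smooth f" "bounded_linear L" "bounded_linear A"
  shows "((\<lambda>z. L (f (A z + c))) has_derivative (\<lambda>v. L (pd (A v) f (A z + c)))) (at z)"
proof -
  have "((\<lambda>z. A z + c) has_derivative A) (at z)"
    by (auto intro!: derivative_eq_intros bounded_linear_imp_has_derivative[OF assms(3)])
  from has_derivative_compose[OF this smooth_has_derivative[OF assms(1)]]
  show ?thesis
    by (rule bounded_linear.has_derivative[OF assms(2)])
qed

lemma smooth_affine_comp:
  assumes "smooth f" "bounded_linear L" "bounded_linear A"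
  shows "smooth (\<lambda>z. L (f (A z + c)))"
proof (rule smooth_coinduct[where P="\<lambda>g. \<exists>f. smooth f \<and> g = (\<lambda>z. L (f (A z + c)))"])
  fix g assume "\<exists>f. smooth f \<and> g = (\<lambda>z. L (f (A z + c)))"
  then obtain f where f: "smooth f" and g: "g = (\<lambda>z. L (f (A z + c)))" by blast
  show "\<exists>g'. (\<forall>x. (g has_derivative g' x) (at x)) \<and>
      (\<forall>v. \<exists>f. smooth f \<and> (\<lambda>x. g' x v) = (\<lambda>z. L (f (A z + c))))"
    unfolding g
    by (rule exI[of _ "\<lambda>z v. L (pd (A v) f (A z + c))"])
      (use has_derivative_affine_comp[OF f assms(2,3)] smooth_pd[OF f] in blast)
qed (use assms in blast)

lemma pd_affine_comp:
  assumes "smooth f" "bounded_linear L" "bounded_linear A"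
  shows "pd v (\<lambda>z. L (f (A z + c))) = (\<lambda>z. L (pd (A v) f (A z + c)))"
  using pd_eq[OF has_derivative_affine_comp[OF assms]] by blast

lemma smooth_linear_comp: "smooth f \<Longrightarrow> bounded_linear L \<Longrightarrow> smooth (\<lambda>z. L (f z))"
  using smooth_affine_comp[of f L "\<lambda>x. x" 0] by (simp add: bounded_linear_ident)

lemma pd_linear_comp: "smooth f \<Longrightarrow> bounded_linear L \<Longrightarrow> pd v (\<lambda>z. L (f z)) = (\<lambda>z. L (pd v f z))"
  using pd_affine_comp[of f L "\<lambda>x. x" v 0] by (simp add: bounded_linear_ident)

lemma foldr_pd_linear_comp:
  "smooth f \<Longrightarrow> bounded_linear L \<Longrightarrow> foldr pd w (\<lambda>z. L (f z)) = (\<lambda>z. L (foldr pd w f z))"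
  by (induction w) (auto simp: pd_linear_comp smooth_foldr_pd)

lemma smooth_diff:
  assumes "smooth f" "smooth g"
  shows "smooth (\<lambda>x. f x - g x)"
proof (rule smooth_coinduct[where P="\<lambda>h. \<exists>f g. smooth f \<and> smooth g \<and> h = (\<lambda>x. f x - g x)"])
  fix h :: "'a \<Rightarrow> 'b" assume "\<exists>f g. smooth f \<and> smooth g \<and> h = (\<lambda>x. f x - g x)"
  then obtain f g where fg: "smooth f" "smooth g" and h: "h = (\<lambda>x. f x - g x)" by blast
  show "\<exists>h'. (\<forall>x. (h has_derivative h' x) (at x)) \<and>
      (\<forall>v. \<exists>f g. smooth f \<and> smooth g \<and> (\<lambda>x. h' x v) = (\<lambda>x. f x - g x))"
    unfolding h
  proof (intro exI[of _ "\<lambda>x v. pd v f x - pd v g x"] conjI allI)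
    show "((\<lambda>x. f x - g x) has_derivative (\<lambda>v. pd v f x - pd v g x)) (at x)" for x
      by (intro has_derivative_diff smooth_has_derivative fg)
    show "\<exists>f' g'. smooth f' \<and> smooth g' \<and> (\<lambda>x. pd v f x - pd v g x) = (\<lambda>x. f' x - g' x)" for v
      using smooth_pd[OF fg(1)] smooth_pd[OF fg(2)] by blast
  qed
qed (use assms in blast)

lemma pd_sum_Basis:
  assumes "smooth f"
  shows "pd v f x = (\<Sum>b\<in>Basis. (v \<bullet> b) *\<^sub>R pd b f x)"
proof -
  interpret bounded_linear "\<lambda>v. pd v f x"
    using smooth_has_derivative[OF assms] by (rule has_derivative_bounded_linear)
  show ?thesis
    by (subst euclidean_representation[of v, symmetric]) (simp only: sum scaleR)
qed

text \<open>The uniform limits \<open>G w\<close> exist for all words at once, and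
  \<open>G (v # w)\<close> is the derivative of \<open>G w\<close> in direction \<open>v\<close> by
  the theorem on sequences of derivatives. The family of all \<open>G w\<close> is thus closed under
  differentiation, and coinduction gives smoothness.\<close>

lemma smooth_uniform_limit:
  fixes f :: "real \<Rightarrow> 'a::euclidean_space \<Rightarrow> 'b::banach"
  assumes sm: "\<And>s. smooth (f s)"
    and cauchy: "\<And>w e. e > 0 \<Longrightarrow> \<exists>S. \<forall>s\<ge>S. \<forall>s'\<ge>S. \<forall>x.
      dist (foldr pd w (f s) x) (foldr pd w (f s') x) < e"
  obtains g where "smooth g"
    and "\<And>w. uniform_limit UNIV (\<lambda>s. foldr pd w (f s)) (foldr pd w g) at_top"
proof -
  have "\<exists>G. uniform_limit UNIV (\<lambda>s. foldr pd w (f s)) G at_top" for w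
  proof -
    \<comment> \<open>Completeness is invoked along the integers; the Cauchy condition then
      transfers the limit to real \<open>s\<close>.\<close>
    have "uniformly_Cauchy_on UNIV (\<lambda>n. foldr pd w (f (real n)))"
      unfolding uniformly_Cauchy_on_def
    proof (intro allI impI)
      fix e :: real assume "e > 0"
      from cauchy[OF this, of w] obtain S where
        S: "\<And>s s' x. s \<ge> S \<Longrightarrow> s' \<ge> S \<Longrightarrow> dist (foldr pd w (f s) x) (foldr pd w (f s') x) < e" by blast
      have "real n \<ge> S" if "n \<ge> nat \<lceil>S\<rceil>" for n using that by linarith
      then show "\<exists>M. \<forall>x\<in>UNIV. \<forall>m\<ge>M. \<forall>n\<ge>M.
          dist (foldr pd w (f (real m)) x) (foldr pd w (f (real n)) x) < e"
        using S by blast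
    qed
    then obtain G where G: "uniform_limit UNIV (\<lambda>n. foldr pd w (f (real n))) G sequentially"
      using Cauchy_uniformly_convergent unfolding uniformly_convergent_on_def by blast
    have "uniform_limit UNIV (\<lambda>s. foldr pd w (f s)) G at_top"
      unfolding uniform_limit_iff
    proof (intro allI impI)
      fix e :: real assume "e > 0"
      then have "e/2 > 0" by simp
      from cauchy[OF this, of w] obtain S where
        S: "\<And>s s' x. s \<ge> S \<Longrightarrow> s' \<ge> S \<Longrightarrow> dist (foldr pd w (f s) x) (foldr pd w (f s') x) < e/2" by blast
      have "\<forall>\<^sub>F n in sequentially. \<forall>x\<in>UNIV. dist (foldr pd w (f (real n)) x) (G x) < e/2"
        using G \<open>e/2 > 0\<close> unfolding uniform_limit_iff by blast
      moreover have "\<forall>\<^sub>F n in sequentially. real n \<ge> S"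
        using filterlim_real_sequentially by (auto simp: filterlim_at_top)
      ultimately have "\<forall>\<^sub>F n in sequentially.
          (\<forall>x\<in>UNIV. dist (foldr pd w (f (real n)) x) (G x) < e/2) \<and> real n \<ge> S"
        by (rule eventually_conj)
      then obtain n where n: "\<And>x. dist (foldr pd w (f (real n)) x) (G x) < e/2" "real n \<ge> S"
        using eventually_happens'[OF sequentially_bot] by fast
      have "dist (foldr pd w (f s) x) (G x) < e" if "s \<ge> S" for s x
        using S[OF that n(2), of x] n(1)[of x] dist_triangle_half_r[of "foldr pd w (f (real n)) x"]
        by (metis dist_commute)
      then show "\<forall>\<^sub>F s in at_top. \<forall>x\<in>UNIV. dist (foldr pd w (f s) x) (G x) < e"
        by - (rule eventually_mono[OF eventually_ge_at_top[of S]], blast)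
    qed
    then show ?thesis by blast
  qed
  then obtain G where G: "\<And>w. uniform_limit UNIV (\<lambda>s. foldr pd w (f s)) (G w) at_top" by metis
  have Gx: "((\<lambda>s. foldr pd w (f s) x) \<longlongrightarrow> G w x) at_top" for w x
    using tendsto_uniform_limitI[OF G] by blast
  \<comment> \<open>Linearity in the direction survives the limit. It is needed because the
    convergence is known for one direction at a time, whereas differentiating the limit requires an
    estimate uniform in \<open>h\<close>.\<close>
  have Gsum: "G (v # w) x = (\<Sum>b\<in>Basis. (v \<bullet> b) *\<^sub>R G (b # w) x)" for v w x
  proof (rule tendsto_unique[OF _ Gx])
    have "((\<lambda>s. \<Sum>b\<in>Basis. (v \<bullet> b) *\<^sub>R foldr pd (b # w) (f s) x) \<longlongrightarrow>
        (\<Sum>b\<in>Basis. (v \<bullet> b) *\<^sub>R G (b # w) x)) at_top"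
      by (intro tendsto_intros Gx)
    then show "((\<lambda>s. foldr pd (v # w) (f s) x) \<longlongrightarrow> (\<Sum>b\<in>Basis. (v \<bullet> b) *\<^sub>R G (b # w) x)) at_top"
      using pd_sum_Basis[OF smooth_foldr_pd[OF sm], of v] by simp
  qed simp
  have Gd: "(G w has_derivative (\<lambda>v. G (v # w) x)) (at x)" for w x
  proof -
    have seq: "(\<lambda>n. foldr pd w (f (real n)) x) \<longlonglongrightarrow> G w x" for w x
      using filterlim_compose[OF Gx filterlim_real_sequentially] .
    have "\<exists>g. \<forall>x\<in>UNIV. (\<lambda>n. foldr pd w (f (real n)) x) \<longlonglongrightarrow> g x \<and>
        (g has_derivative (\<lambda>v. G (v # w) x)) (at x within UNIV)"
    proof (rule has_derivative_sequence)
      show "(\<lambda>n. foldr pd w (f (real n)) 0) \<longlonglongrightarrow> G w 0" by (rule seq)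
      show "(foldr pd w (f (real n)) has_derivative (\<lambda>v. pd v (foldr pd w (f (real n))) x)) (at x within UNIV)" for n x
        using smooth_has_derivative[OF smooth_foldr_pd[OF sm]] by simp
      fix e :: real assume "e > 0"
      \<comment> \<open>Each of the \<open>DIM('a)\<close> basis directions may contribute
        \<open>d\<close> to the operator norm, for a total of \<open>e\<close>.\<close>
      define d where "d = e / DIM('a)"
      have d: "d > 0" using \<open>e > 0\<close> by (simp add: d_def)
      have "\<forall>\<^sub>F n in sequentially. \<forall>x\<in>UNIV. dist (foldr pd (b # w) (f (real n)) x) (G (b # w) x) < d" for b
        using uniform_limitD[OF G[of "b # w"] d] filterlim_real_sequentially
        by (rule eventually_compose_filterlim)
      then have "\<forall>\<^sub>F n in sequentially. \<forall>b\<in>Basis. \<forall>x\<in>UNIV. dist (foldr pd (b # w) (f (real n)) x) (G (b # w) x) < d"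
        by (intro eventually_ball_finite) auto
      then show "\<forall>\<^sub>F n in sequentially. \<forall>x\<in>UNIV. \<forall>h. norm (pd h (foldr pd w (f (real n))) x - G (h # w) x) \<le> e * norm h"
      proof eventually_elim
        case (elim n)
        show ?case
        proof (intro ballI allI)
          fix x h
          have "norm (pd h (foldr pd w (f (real n))) x - G (h # w) x)
            = norm (\<Sum>b\<in>Basis. (h \<bullet> b) *\<^sub>R (pd b (foldr pd w (f (real n))) x - G (b # w) x))"
            by (subst pd_sum_Basis[OF smooth_foldr_pd[OF sm]], subst Gsum)
              (simp add: sum_subtractf scaleR_diff_right)
          also have "\<dots> \<le> (\<Sum>b\<in>(Basis::'a set). norm h * d)"
          proof (rule sum_norm_le)
            fix b :: 'a assume b: "b \<in> Basis"
            have "norm (pd b (foldr pd w (f (real n))) x - G (b # w) x) \<le> d"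
              using elim b by (auto simp: dist_norm less_imp_le)
            then show "norm ((h \<bullet> b) *\<^sub>R (pd b (foldr pd w (f (real n))) x - G (b # w) x)) \<le> norm h * d"
              using Basis_le_norm[OF b, of h] by (auto intro: mult_mono)
          qed
          also have "\<dots> = e * norm h" by (simp add: d_def)
          finally show "norm (pd h (foldr pd w (f (real n))) x - G (h # w) x) \<le> e * norm h" .
        qed
      qed
    qed auto
    then obtain g where g: "\<And>x. (\<lambda>n. foldr pd w (f (real n)) x) \<longlonglongrightarrow> g x"
      "\<And>x. (g has_derivative (\<lambda>v. G (v # w) x)) (at x)" by auto
    have "g = G w" using LIMSEQ_unique[OF g(1) seq] by auto
    with g(2) show ?thesis by simp
  qed
  have "foldr pd w (G []) = G w" for w
  proof (induction w)
    case (Cons v w)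
    then show ?case using pd_eq[OF Gd] by auto
  qed simp
  moreover have "smooth (G [])"
    by (rule smooth_coinduct[where P="\<lambda>g. \<exists>w. g = G w"]) (use Gd in fast)+
  ultimately show thesis using that[of "G []"] G by simp
qed

section \<open>Fourier coefficients on the circle\<close>

lemma has_vector_derivative_cis_linear:
  "((\<lambda>t. cis (a * (t - b))) has_vector_derivative (\<i> * of_real a * cis (a * (t - b)))) (at t within S)"
  unfolding has_vector_derivative_def
  by (auto intro!: derivative_eq_intros simp: scaleR_conv_of_real mult_ac)

lemma has_vector_derivative_quotient_tendsto:
  assumes "(f has_vector_derivative D) (at x)"
  shows "((\<lambda>y. (f y - f x) /\<^sub>R (y - x)) \<longlongrightarrow> D) (at x)"
proof -
  have "((\<lambda>y. norm (f y - f x - (y - x) *\<^sub>R D) / norm (y - x)) \<longlongrightarrow> 0) (at x)"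
    using assms unfolding has_vector_derivative_def has_derivative_iff_norm by blast
  moreover have "\<forall>\<^sub>F y in at x. norm (f y - f x - (y - x) *\<^sub>R D) / norm (y - x)
      = norm ((f y - f x) /\<^sub>R (y - x) - D)"
  proof (rule eventually_mono[OF eventually_neq_at_within[of x]])
    fix y :: real assume "y \<noteq> x"
    then have "(f y - f x) /\<^sub>R (y - x) - D = (f y - f x - (y - x) *\<^sub>R D) /\<^sub>R (y - x)"
      by (simp add: scaleR_diff_right)
    then show "norm (f y - f x - (y - x) *\<^sub>R D) / norm (y - x) = norm ((f y - f x) /\<^sub>R (y - x) - D)"
      by (simp add: divide_inverse_commute)
  qed
  ultimately have "((\<lambda>y. norm ((f y - f x) /\<^sub>R (y - x) - D)) \<longlongrightarrow> 0) (at x)"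
    by (rule Lim_transform_eventually)
  then show ?thesis using tendsto_norm_zero_iff LIM_zero_cancel by blast
qed

text \<open>Up to \<open>e / 2\<close> the function may be replaced by a polynomial, by
  Stone-Weierstrass. For a polynomial, one integration by parts gives a bound of order 1/|\<omega>|,
  and \<open>N\<close> is chosen to make that bound smaller than \<open>e / 2\<close>.\<close>

lemma riemann_lebesgue:
  fixes g :: "real \<Rightarrow> complex"
  assumes ab: "a \<le> b" and g: "continuous_on {a..b} g" and e: "e > 0"
  shows "\<exists>N>0. \<forall>\<omega>. \<bar>\<omega>\<bar> \<ge> N \<longrightarrow> norm (integral {a..b} (\<lambda>t. g t * cis (\<omega> * (t - c)))) < e"
proof -
  define d where "d = e / (2 * (b - a + 1))"
  have d: "d > 0" using ab e by (simp add: d_def)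
  obtain p where p: "polynomial_function p" and gp: "\<And>t. t \<in> {a..b} \<Longrightarrow> norm (g t - p t) < d"
    using Stone_Weierstrass_polynomial_function[OF _ g d] by auto
  obtain p' where p': "polynomial_function p'" and dp: "\<And>x. (p has_vector_derivative p' x) (at x)"
    using has_vector_derivative_polynomial_function[OF p] by blast
  have cp: "continuous_on {a..b} p" "continuous_on {a..b} p'"
    using p p' continuous_on_polymonial_function by auto
  obtain K where K: "\<And>t. t \<in> {a..b} \<Longrightarrow> norm (p t) \<le> K"
    using compact_imp_bounded[OF compact_continuous_image[OF cp(1) compact_Icc]] unfolding bounded_iff by blast
  obtain K' where K': "\<And>t. t \<in> {a..b} \<Longrightarrow> norm (p' t) \<le> K'"
    using compact_imp_bounded[OF compact_continuous_image[OF cp(2) compact_Icc]] unfolding bounded_iff by blast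
  have "K \<ge> 0" "K' \<ge> 0"
    using order_trans[OF norm_ge_zero K[of a]] order_trans[OF norm_ge_zero K'[of a]] ab by auto
  define N where "N = (2 * K + K' * (b - a)) * 2 / e + 1"
  have N: "N > 0" using \<open>K \<ge> 0\<close> \<open>K' \<ge> 0\<close> ab e by (simp add: N_def add_nonneg_pos)
  have "norm (integral {a..b} (\<lambda>t. g t * cis (\<omega> * (t - c)))) < e" if w: "\<bar>\<omega>\<bar> \<ge> N" for \<omega>
  proof -
    have w0: "\<omega> \<noteq> 0" using w N by auto
    let ?E = "\<lambda>t. cis (\<omega> * (t - c))"
    let ?F = "\<lambda>t. p t * ?E t / (\<i> * \<omega>)"
    note [continuous_intros] = cp g
    have ints: "(\<lambda>t. p t * ?E t) integrable_on {a..b}" "(\<lambda>t. p' t * ?E t / (\<i> * \<omega>)) integrable_on {a..b}"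
      "(\<lambda>t. (g t - p t) * ?E t) integrable_on {a..b}" "(\<lambda>t. g t * ?E t) integrable_on {a..b}"
      using w0 by (auto intro!: integrable_continuous_real continuous_intros)
    have "((\<lambda>t. p' t * ?E t / (\<i> * \<omega>) + p t * ?E t) has_integral (?F b - ?F a)) {a..b}"
    proof (rule fundamental_theorem_of_calculus[OF ab])
      fix t
      have "((\<lambda>t. p t * ?E t) has_vector_derivative (p t * (\<i> * of_real \<omega> * ?E t) + p' t * ?E t)) (at t within {a..b})"
        by (intro has_vector_derivative_mult has_vector_derivative_cis_linear
            has_vector_derivative_at_within[OF dp])
      from has_vector_derivative_divide[OF this, of "\<i> * \<omega>"]
      show "(?F has_vector_derivative p' t * ?E t / (\<i> * \<omega>) + p t * ?E t) (at t within {a..b})"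
        by (rule has_vector_derivative_eq_rhs) (use w0 in \<open>simp add: field_simps\<close>)
    qed
    then have "integral {a..b} (\<lambda>t. p' t * ?E t / (\<i> * \<omega>)) + integral {a..b} (\<lambda>t. p t * ?E t) = ?F b - ?F a"
      by (subst integral_add[OF ints(2,1), symmetric]) (rule integral_unique)
    then have "integral {a..b} (\<lambda>t. p t * ?E t) = ?F b - ?F a - integral {a..b} (\<lambda>t. p' t * ?E t / (\<i> * \<omega>))"
      by (simp add: algebra_simps)
    then have eq: "norm (integral {a..b} (\<lambda>t. p t * ?E t)) = norm (?F b - ?F a - integral {a..b} (\<lambda>t. p' t * ?E t / (\<i> * \<omega>)))"
      by (rule arg_cong)
    have "norm (integral {a..b} (\<lambda>t. p t * ?E t)) \<le> norm (?F b) + norm (?F a) + norm (integral {a..b} (\<lambda>t. p' t * ?E t / (\<i> * \<omega>)))"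
      unfolding eq using norm_triangle_ineq4[of "?F b - ?F a" "integral {a..b} (\<lambda>t. p' t * ?E t / (\<i> * \<omega>))"]
        norm_triangle_ineq4[of "?F b" "?F a"] by linarith
    also have "\<dots> \<le> K / \<bar>\<omega>\<bar> + K / \<bar>\<omega>\<bar> + (K' / \<bar>\<omega>\<bar>) * (b - a)"
    proof (intro add_mono)
      show "norm (?F b) \<le> K / \<bar>\<omega>\<bar>" "norm (?F a) \<le> K / \<bar>\<omega>\<bar>"
        using K[of a] K[of b] ab by (auto simp: norm_mult norm_divide intro!: divide_right_mono)
      show "norm (integral {a..b} (\<lambda>t. p' t * ?E t / (\<i> * \<omega>))) \<le> (K' / \<bar>\<omega>\<bar>) * (b - a)"
        using K' w0 by (intro integral_bound[OF ab])
          (auto simp: norm_mult norm_divide intro!: divide_right_mono continuous_intros)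
    qed
    also have "\<dots> = (2 * K + K' * (b - a)) / \<bar>\<omega>\<bar>" by (simp add: add_divide_distrib)
    also have "\<dots> < e / 2"
    proof -
      have "(2 * K + K' * (b - a)) * 2 / e < \<bar>\<omega>\<bar>" using w by (simp add: N_def)
      then show ?thesis using w0 e by (simp add: field_simps)
    qed
    finally have 1: "norm (integral {a..b} (\<lambda>t. p t * ?E t)) < e / 2" .
    have "norm (integral {a..b} (\<lambda>t. (g t - p t) * ?E t)) \<le> d * (b - a)"
      using gp by (intro integral_bound[OF ab]) (auto simp: norm_mult less_imp_le intro!: continuous_intros)
    also have "\<dots> \<le> e / 2" using ab e by (simp add: d_def field_simps)
    finally have 2: "norm (integral {a..b} (\<lambda>t. (g t - p t) * ?E t)) \<le> e / 2" .
    have "integral {a..b} (\<lambda>t. g t * ?E t) = integral {a..b} (\<lambda>t. (g t - p t) * ?E t) + integral {a..b} (\<lambda>t. p t * ?E t)"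
      by (subst integral_add[OF ints(3,1), symmetric]) (simp add: algebra_simps)
    then show ?thesis using 1 2 norm_triangle_ineq[of "integral {a..b} (\<lambda>t. (g t - p t) * ?E t)" "integral {a..b} (\<lambda>t. p t * ?E t)"]
      by simp
  qed
  then show ?thesis using N by blast
qed

lemma sum_int_telescope:
  fixes a :: "int \<Rightarrow> 'a::ab_group_add"
  shows "(\<Sum>m\<in>{-int N..int N}. a (m - 1) - a m) = a (- int N - 1) - a (int N)"
proof (induction N)
  case (Suc N)
  have "{-int (Suc N)..int (Suc N)} = insert (-int (Suc N)) (insert (int (Suc N)) {-int N..int N})" by auto
  moreover have "a (- int N - 1) = a (- 1 - int N)" by (rule arg_cong[of _ _ a]) simp
  ultimately show ?case using Suc by (simp add: algebra_simps)
qed simp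

text \<open>The correction \<open>4 / (N + 1)\<close> makes the induction close: the two new terms
  at N + 1 and -(N + 1) cost no more than its decrease. It is exact at N = 0, and dropping it leaves
  the absolute constant 5 of the sup bounds.\<close>

lemma sum_int_inverse_square_le: "(\<Sum>m\<in>{-int N..int N}. 1 / (1 + (real_of_int m)\<^sup>2)) \<le> 5 - 4 / (real N + 1)"
proof (induction N)
  case (Suc N)
  have "{-int (Suc N)..int (Suc N)} = insert (-int (Suc N)) (insert (int (Suc N)) {-int N..int N})" by auto
  then have "(\<Sum>m\<in>{-int (Suc N)..int (Suc N)}. 1 / (1 + (real_of_int m)\<^sup>2))
     = 2 / (1 + (real N + 1)\<^sup>2) + (\<Sum>m\<in>{-int N..int N}. 1 / (1 + (real_of_int m)\<^sup>2))"
    by (simp add: power2_eq_square algebra_simps)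
  moreover have "2 / (1 + (real N + 1)\<^sup>2) \<le> 4 / (real N + 1) - 4 / (real N + 2)"
  proof -
    have "4 / (real N + 1) - 4 / (real N + 2) = 4 / ((real N + 1) * (real N + 2))"
      by (simp add: field_simps)
    moreover have "2 * ((real N + 1) * (real N + 2)) \<le> 4 * (1 + (real N + 1)\<^sup>2)"
      by (simp add: power2_eq_square algebra_simps)
    ultimately show ?thesis
      by (simp add: divide_le_eq pos_le_divide_eq add_pos_nonneg mult.commute)
  qed
  ultimately show ?case using Suc by (simp add: algebra_simps)
qed simp

text \<open>The symmetric partial sums of the unnormalised coefficients, with phases centred at
  \<open>t0\<close>, tend to \<open>P * h t0\<close>, while each of them is at most \<open>B\<close>
  times the sum of 1/(1 + m^2). Differentiability of \<open>h\<close> makes the quotient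
  \<open>g\<close> continuous, so Riemann-Lebesgue disposes of the two boundary terms of the
  telescoping sum.\<close>

lemma fourier_sup_bound_1d:
  fixes h :: "real \<Rightarrow> complex"
  assumes P: "P > 0" and per: "\<And>t. h (t + P) = h t"
    and hd: "\<And>t. (h has_vector_derivative h' t) (at t)"
    and B: "\<And>m::int. (1 + (real_of_int m)\<^sup>2) *
      norm (integral {0..P} (\<lambda>t. h t * cis (- (of_int m * (2 * pi / P) * t)))) \<le> B"
  shows "P * norm (h t0) \<le> 5 * B"
proof -
  define R where "R = 2 * pi / P"
  have R: "R > 0" using P by (simp add: R_def)
  have RP: "R * P = 2 * pi" using P by (simp add: R_def)
  interpret h: periodic_fun_simple h P by standard (rule per)
  define E where "E t = cis (R * (t - t0))" for t
  \<comment> \<open>Chernoff's trick: dividing by E - 1 turns the partial Fourier sums of h - h t0 into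
    telescoping sums of the coefficients of the continuous function g.\<close>
  define g where "g t = (if E t = 1 then h' t0 / (\<i> * R) else (h t - h t0) / (E t - 1))" for t
  define d where "d f m = integral {0..P} (\<lambda>t. f t * cis ((- of_int m * R) * (t - t0)))" for f :: "real \<Rightarrow> complex" and m :: int
  have Ed: "(E has_vector_derivative (\<i> * of_real R * E t)) (at t)" for t
    unfolding E_def by (rule has_vector_derivative_cis_linear)
  have hc: "continuous_on S h" for S
    using hd by (meson has_vector_derivative_continuous continuous_at_imp_continuous_on)
  have Ec: "continuous_on S E" for S
    using Ed by (meson has_vector_derivative_continuous continuous_at_imp_continuous_on)
  \<comment> \<open>\<open>E\<close> equals 1 exactly on the translates of \<open>t0\<close> by
    multiples of \<open>P\<close>. Periodicity of \<open>h\<close> and \<open>h'\<close> makes the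
    single default value in \<open>g\<close> the correct limit at all of them.\<close>
  have E1: "h t = h t0 \<and> h' t = h' t0" if "E t = 1" for t
  proof -
    have "cos (R * (t - t0)) = 1" using that by (simp add: E_def complex_eq_iff)
    then obtain k :: int where "R * (t - t0) = of_int k * (2 * pi)" using cos_one_2pi_int by (metis mult.assoc)
    then have "R * (t - t0) = R * (of_int k * P)" using RP by (simp add: mult_ac)
    then have t: "t = t0 + of_int k * P" using R by simp
    have "(h \<circ> (\<lambda>t. t + of_int k * P) has_vector_derivative (1 *\<^sub>R h' (t0 + of_int k * P))) (at t0)"
      by (rule vector_diff_chain_at) (auto intro!: derivative_eq_intros hd)
    moreover have "h \<circ> (\<lambda>t. t + of_int k * P) = h" by (auto simp: h.plus_of_int)
    ultimately have "h' t = h' t0" using vector_derivative_unique_at[OF hd] by (simp add: t)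
    then show ?thesis by (simp add: t h.plus_of_int)
  qed
  have "isCont g t1" for t1
  proof (cases "E t1 = 1")
    case True
    have l: "((\<lambda>t. (E t - E t1) /\<^sub>R (t - t1)) \<longlongrightarrow> \<i> * of_real R * E t1) (at t1)"
      by (rule has_vector_derivative_quotient_tendsto[OF Ed])
    have l': "((\<lambda>t. ((h t - h t1) /\<^sub>R (t - t1)) / ((E t - E t1) /\<^sub>R (t - t1))) \<longlongrightarrow> h' t1 / (\<i> * of_real R * E t1)) (at t1)"
      by (intro tendsto_divide l has_vector_derivative_quotient_tendsto[OF hd]) (use R True in simp)
    have "\<forall>\<^sub>F t in at t1. (E t - E t1) /\<^sub>R (t - t1) \<noteq> 0"
      by (rule tendsto_imp_eventually_ne[OF l]) (use R True in simp)
    then have "\<forall>\<^sub>F t in at t1. ((h t - h t1) /\<^sub>R (t - t1)) / ((E t - E t1) /\<^sub>R (t - t1)) = g t"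
    proof eventually_elim
      case (elim t)
      then have "t \<noteq> t1" "E t \<noteq> 1" using True by auto
      then show ?case using True E1[OF True] by (simp add: g_def scaleR_conv_of_real)
    qed
    with l' have "(g \<longlongrightarrow> h' t1 / (\<i> * of_real R * E t1)) (at t1)" by (rule Lim_transform_eventually)
    then show ?thesis using True E1[OF True] by (simp add: isCont_def g_def)
  next
    case False
    have "open {t. E t \<noteq> 1}"
      using open_Collect_neq[OF Ec continuous_on_const] .
    then have "\<forall>\<^sub>F t in nhds t1. E t \<noteq> 1"
      using eventually_nhds_in_open[of "{t. E t \<noteq> 1}" t1] False by simp
    then have ev: "\<forall>\<^sub>F t in nhds t1. (h t - h t0) / (E t - 1) = g t"
      by eventually_elim (simp add: g_def)
    have "isCont (\<lambda>t. (h t - h t0) / (E t - 1)) t1"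
      using False hc[of UNIV] Ec[of UNIV] by (auto intro!: continuous_intros simp: continuous_on_eq_continuous_at)
    then show ?thesis using isCont_cong[OF ev] by simp
  qed
  then have gc: "continuous_on S g" for S by (simp add: continuous_at_imp_continuous_on)
  have hg: "h t - h t0 = g t * (E t - 1)" for t
    using E1[of t] by (auto simp: g_def)
  note [continuous_intros] = gc hc Ec
  \<comment> \<open>Multiplication by \<open>E\<close> lowers the index of a coefficient by one, so
    \<open>g * (E - 1)\<close> contributes a difference of neighbouring coefficients of
    \<open>g\<close>.\<close>
  have dh: "d h m = d (\<lambda>t. h t0) m + (d g (m - 1) - d g m)" for m
  proof -
    have "h t * cis ((- of_int m * R) * (t - t0)) = h t0 * cis ((- of_int m * R) * (t - t0)) +
      (g t * cis ((- of_int (m - 1) * R) * (t - t0)) - g t * cis ((- of_int m * R) * (t - t0)))" for t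
    proof -
      have 1: "cis ((- of_int (m - 1) * R) * (t - t0)) = cis ((- of_int m * R) * (t - t0)) * E t"
        by (simp add: E_def cis_mult algebra_simps)
      have 2: "h t = h t0 + g t * (E t - 1)" using hg[of t] by (simp add: algebra_simps)
      have "(h t0 + g t * (E t - 1)) * c = h t0 * c + (g t * (c * E t) - g t * c)" for c
        by (simp add: algebra_simps)
      then show ?thesis unfolding 1 2 .
    qed
    then show ?thesis unfolding d_def
      by (subst integral_diff[symmetric], (intro integrable_continuous_real continuous_intros)+,
          subst integral_add[symmetric], (intro integrable_continuous_real continuous_intros)+) simp
  qed
  have dc: "d (\<lambda>t. c) m = (if m = 0 then of_real P * c else 0)" for c m
  proof (cases "m = 0")
    case True
    then show ?thesis using P by (simp add: d_def scaleR_conv_of_real)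
  next
    case False
    define w where "w = - of_int m * R"
    have w: "w \<noteq> 0" using False R by (simp add: w_def)
    have "((\<lambda>t. c * cis (w * (t - t0))) has_integral
        (c * cis (w * (P - t0)) / (\<i> * w) - c * cis (w * (0 - t0)) / (\<i> * w))) {0..P}"
    proof (rule fundamental_theorem_of_calculus)
      fix t
      have "((\<lambda>t. c * cis (w * (t - t0)) / (\<i> * w)) has_vector_derivative (c * (\<i> * w * cis (w * (t - t0))) / (\<i> * w))) (at t within {0..P})"
        by (intro has_vector_derivative_divide has_vector_derivative_mult_right has_vector_derivative_cis_linear)
      then show "((\<lambda>t. c * cis (w * (t - t0)) / (\<i> * w)) has_vector_derivative c * cis (w * (t - t0))) (at t within {0..P})"
        using w by simp
    qed (use P in simp)
    moreover have "cis (w * (P - t0)) = cis (w * (0 - t0))"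
    proof -
      have "w * (P - t0) = 2 * pi * of_int (-m) + w * (0 - t0)"
        using RP by (simp add: w_def algebra_simps)
      then show ?thesis
        using cis_multiple_2pi[OF Ints_of_int[of "-m"]] by (simp only: cis_mult[symmetric] mult_1)
    qed
    ultimately have "((\<lambda>t. c * cis (w * (t - t0))) has_integral 0) {0..P}" by simp
    then have "d (\<lambda>t. c) m = 0" unfolding d_def w_def[symmetric] by (rule integral_unique)
    then show ?thesis using False by simp
  qed
  \<comment> \<open>Moving the base point of the phase from 0 to \<open>t0\<close> multiplies a
    coefficient by a number of modulus one, so the hypothesis on \<open>B\<close> applies
    unchanged.\<close>
  have nd: "norm (d h m) \<le> B / (1 + (real_of_int m)\<^sup>2)" for m
  proof -
    have "d h m = integral {0..P} (\<lambda>t. (h t * cis (- (of_int m * (2 * pi / P) * t))) * cis (of_int m * R * t0))"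
      unfolding d_def R_def by (rule integral_cong) (simp add: mult.assoc cis_mult algebra_simps diff_divide_distrib)
    then have "norm (d h m) = norm (integral {0..P} (\<lambda>t. h t * cis (- (of_int m * (2 * pi / P) * t))))"
      by (simp add: norm_mult)
    then have "(1 + (real_of_int m)\<^sup>2) * norm (d h m) \<le> B" using B[of m] by simp
    moreover have "1 + (real_of_int m)\<^sup>2 > 0" by (simp add: add_pos_nonneg)
    ultimately show ?thesis by (simp add: pos_le_divide_eq mult.commute)
  qed
  have B0: "B \<ge> 0" using B[of 0] by (simp add: order_trans[OF norm_ge_zero])
  show ?thesis
  proof (rule field_le_epsilon)
    fix e :: real assume "e > 0"
    then have "e / 2 > 0" by simp
    from riemann_lebesgue[OF _ gc this, of 0 P t0] P obtain N0 where N0: "N0 > 0"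
      "\<And>w. \<bar>w\<bar> \<ge> N0 \<Longrightarrow> norm (integral {0..P} (\<lambda>t. g t * cis (w * (t - t0)))) < e / 2" by auto
    define N where "N = nat \<lceil>N0 / R\<rceil>"
    have "real N \<ge> N0 / R" unfolding N_def by linarith
    then have NR: "real N * R \<ge> N0" using R by (simp add: field_simps)
    have small: "norm (d g m) < e / 2" if "\<bar>m\<bar> \<ge> int N" for m
    proof -
      have "real N \<le> \<bar>real_of_int m\<bar>" using that by linarith
      then have "real N * R \<le> \<bar>- of_int m * R\<bar>" using R by (simp add: abs_mult)
      then show ?thesis unfolding d_def using NR by (intro N0(2)) linarith
    qed
    have "(\<Sum>m\<in>{-int N..int N}. d h m) = of_real P * h t0 + (d g (- int N - 1) - d g (int N))"
      unfolding dh sum.distrib sum_int_telescope dc by (simp add: sum.delta)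
    then have "of_real P * h t0 = (\<Sum>m\<in>{-int N..int N}. d h m) - (d g (- int N - 1) - d g (int N))"
      by simp
    then have eq: "norm (of_real P * h t0) = norm ((\<Sum>m\<in>{-int N..int N}. d h m) - (d g (- int N - 1) - d g (int N)))"
      by (rule arg_cong)
    have "norm (of_real P * h t0) \<le> norm (\<Sum>m\<in>{-int N..int N}. d h m) + (norm (d g (- int N - 1)) + norm (d g (int N)))"
      unfolding eq using norm_triangle_ineq4[of "\<Sum>m\<in>{-int N..int N}. d h m" "d g (- int N - 1) - d g (int N)"]
        norm_triangle_ineq4[of "d g (- int N - 1)" "d g (int N)"] by linarith
    also have "\<dots> \<le> 5 * B + (e / 2 + e / 2)"
    proof (intro add_mono)
      have "norm (\<Sum>m\<in>{-int N..int N}. d h m) \<le> (\<Sum>m\<in>{-int N..int N}. B * (1 / (1 + (real_of_int m)\<^sup>2)))"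
        using nd by (intro sum_norm_le) simp
      also have "\<dots> = B * (\<Sum>m\<in>{-int N..int N}. 1 / (1 + (real_of_int m)\<^sup>2))"
        by (simp add: sum_distrib_left)
      also have "\<dots> \<le> B * 5"
      proof (rule mult_left_mono[OF _ B0])
        have "4 / (real N + 1) \<ge> 0" by simp
        then show "(\<Sum>m\<in>{-int N..int N}. 1 / (1 + (real_of_int m)\<^sup>2)) \<le> 5"
          using sum_int_inverse_square_le[of N] by linarith
      qed
      finally show "norm (\<Sum>m\<in>{-int N..int N}. d h m) \<le> 5 * B" by simp
    qed (use small[of "- int N - 1"] small[of "int N"] in auto)
    finally show "P * norm (h t0) \<le> 5 * B + e" using P by (simp add: norm_mult)
  qed
qed

section \<open>Fourier coefficients on the torus\<close>

text \<open>This linear form plays two roles: at a point it is the phase of a mode, and at a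
  direction \<open>v\<close> it is, up to the factor i, the symbol of \<open>pd v\<close>.\<close>

definition freq :: "real \<Rightarrow> int \<Rightarrow> int \<Rightarrow> real \<times> real \<Rightarrow> real" where
  "freq T m n v = of_int m * (2 * pi / T) * fst v + of_int n * snd v"

definition fmode :: "real \<Rightarrow> int \<Rightarrow> int \<Rightarrow> real \<times> real \<Rightarrow> complex" where
  "fmode T m n z = cis (- freq T m n z)"

text \<open>The coefficient is not normalised; the area \<open>2 * pi * T\<close> of the torus
  therefore appears explicitly in the estimates.\<close>

definition fcoef :: "real \<Rightarrow> int \<Rightarrow> int \<Rightarrow> (real \<times> real \<Rightarrow> complex) \<Rightarrow> complex" where
  "fcoef T m n f = integral (cbox (0, 0) (T, 2 * pi)) (\<lambda>z. f z * fmode T m n z)"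

definition torus_periodic :: "real \<Rightarrow> (real \<times> real \<Rightarrow> 'a) \<Rightarrow> bool" where
  "torus_periodic T f \<longleftrightarrow> (\<forall>t x. f (t + T, x) = f (t, x) \<and> f (t, x + 2 * pi) = f (t, x))"

lemma bounded_linear_freq: "bounded_linear (freq T m n)"
  unfolding freq_def[abs_def]
  by (intro bounded_linear_add bounded_linear_const_mult bounded_linear_fst bounded_linear_snd)

lemma fmode_has_derivative:
  "(fmode T m n has_derivative (\<lambda>v. - \<i> * of_real (freq T m n v) * fmode T m n z)) (at z)"
  using has_derivative_cis[OF has_derivative_minus[OF bounded_linear_imp_has_derivative[OF bounded_linear_freq]], of T m n z UNIV]
  by (simp add: fmode_def[abs_def] scaleR_conv_of_real mult_ac)

lemma continuous_on_fmode [continuous_intros]: "continuous_on S (fmode T m n)"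
  using fmode_has_derivative by (meson continuous_at_imp_continuous_on has_derivative_continuous)

lemma norm_fmode [simp]: "norm (fmode T m n z) = 1"
  by (simp add: fmode_def)

lemma torus_periodic_mult:
  "torus_periodic T f \<Longrightarrow> torus_periodic T g \<Longrightarrow> torus_periodic T (\<lambda>z. f z * g z)"
  by (simp add: torus_periodic_def)

lemma torus_periodic_fmode:
  assumes "T > 0"
  shows "torus_periodic T (fmode T m n)"
proof -
  have "fmode T m n (t + T, x) = fmode T m n (t, x)" for t x
  proof -
    have "- freq T m n (t + T, x) = 2 * pi * of_int (-m) + - freq T m n (t, x)"
      using assms by (simp add: freq_def field_simps)
    then show ?thesis
      using cis_multiple_2pi[OF Ints_of_int[of "-m"]] unfolding fmode_def by (simp only: cis_mult[symmetric] mult_1)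
  qed
  moreover have "fmode T m n (t, x + 2 * pi) = fmode T m n (t, x)" for t x
  proof -
    have "- freq T m n (t, x + 2 * pi) = 2 * pi * of_int (-n) + - freq T m n (t, x)"
      by (simp add: freq_def algebra_simps)
    then show ?thesis
      using cis_multiple_2pi[OF Ints_of_int[of "-n"]] unfolding fmode_def by (simp only: cis_mult[symmetric] mult_1)
  qed
  ultimately show ?thesis by (simp add: torus_periodic_def)
qed

lemma has_vector_derivative_fst:
  assumes "(G has_derivative G') (at (t, x))"
  shows "((\<lambda>t. G (t, x)) has_vector_derivative G' (1, 0)) (at t within S)"
proof -
  have "((\<lambda>t. (t, x)) has_derivative (\<lambda>h. (h, 0))) (at t within S)"
    by (auto intro!: derivative_eq_intros)
  moreover have "(G has_derivative G') (at (t, x) within (\<lambda>t. (t, x)) ` S)"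
    using assms has_derivative_at_withinI by blast
  ultimately have d: "((\<lambda>t. G (t, x)) has_derivative (\<lambda>h. G' (h, 0))) (at t within S)"
    using has_derivative_in_compose by fast
  interpret bounded_linear G' using assms by (rule has_derivative_bounded_linear)
  have "(\<lambda>h. G' (h, 0)) = (\<lambda>h. h *\<^sub>R G' (1, 0))"
  proof
    show "G' (h, 0) = h *\<^sub>R G' (1, 0)" for h using scaleR[of h "(1, 0)"] by simp
  qed
  with d show ?thesis by (simp only: has_vector_derivative_def)
qed

lemma has_vector_derivative_snd:
  assumes "(G has_derivative G') (at (t, x))"
  shows "((\<lambda>x. G (t, x)) has_vector_derivative G' (0, 1)) (at x within S)"
proof -
  have "((\<lambda>x. (t, x)) has_derivative (\<lambda>h. (0, h))) (at x within S)"
    by (auto intro!: derivative_eq_intros)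
  moreover have "(G has_derivative G') (at (t, x) within (\<lambda>x. (t, x)) ` S)"
    using assms has_derivative_at_withinI by blast
  ultimately have d: "((\<lambda>x. G (t, x)) has_derivative (\<lambda>h. G' (0, h))) (at x within S)"
    using has_derivative_in_compose by fast
  interpret bounded_linear G' using assms by (rule has_derivative_bounded_linear)
  have "(\<lambda>h. G' (0, h)) = (\<lambda>h. h *\<^sub>R G' (0, 1))"
  proof
    show "G' (0, h) = h *\<^sub>R G' (0, 1)" for h using scaleR[of h "(0, 1)"] by simp
  qed
  with d show ?thesis by (simp only: has_vector_derivative_def)
qed

lemma torus_periodic_derivative:
  assumes per: "torus_periodic T f" and d: "\<And>z. (f has_derivative f' z) (at z)"
  shows "torus_periodic T (\<lambda>z. f' z v)"
proof -
  have "f' (z + c) = f' z" if "\<And>z. f (z + c) = f z" for z c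
  proof -
    have "((\<lambda>z. z + c) has_derivative (\<lambda>v. v)) (at z)" by (auto intro!: derivative_eq_intros)
    from has_derivative_compose[OF this d] have "(f has_derivative f' (z + c)) (at z)"
      using that by simp
    then show ?thesis using has_derivative_unique[OF d] by metis
  qed
  from this[of "(T, 0)"] this[of "(0, 2 * pi)"] per show ?thesis
    unfolding torus_periodic_def by (simp add: split_paired_all)
qed

text \<open>For a coordinate direction, integrating in that variable first leaves a difference of
  values at points identified by periodicity. A general direction is a linear combination of the
  two.\<close>

lemma integral_torus_derivative_eq_0:
  fixes G :: "real \<times> real \<Rightarrow> complex"
  assumes T: "T > 0" and d: "\<And>z. (G has_derivative G' z) (at z)"
    and c: "\<And>v. continuous_on UNIV (\<lambda>z. G' z v)" and per: "torus_periodic T G"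
  shows "integral (cbox (0, 0) (T, 2 * pi)) (\<lambda>z. G' z v) = 0"
proof -
  let ?B = "cbox (0, 0) (T, 2 * pi)"
  have cB: "continuous_on ?B (\<lambda>z. G' z v)" for v using c continuous_on_subset by blast
  have x: "integral ?B (\<lambda>z. G' z (0, 1)) = 0"
  proof -
    have "integral {0..2*pi} (\<lambda>x. G' (t, x) (0, 1)) = 0" for t
    proof -
      have "((\<lambda>x. G' (t, x) (0, 1)) has_integral (G (t, 2 * pi) - G (t, 0))) {0..2*pi}"
        by (rule fundamental_theorem_of_calculus) (auto intro!: has_vector_derivative_snd d)
      moreover have "G (t, 2 * pi) = G (t, 0)" using per unfolding torus_periodic_def by (metis add_0)
      ultimately show ?thesis by (simp add: integral_unique)
    qed
    then show ?thesis by (simp add: integral_prod_continuous[OF cB])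
  qed
  have t: "integral ?B (\<lambda>z. G' z (1, 0)) = 0"
  proof -
    have "integral {0..T} (\<lambda>t. G' (t, x) (1, 0)) = 0" for x
    proof -
      have "((\<lambda>t. G' (t, x) (1, 0)) has_integral (G (T, x) - G (0, x))) {0..T}"
        using T by (intro fundamental_theorem_of_calculus) (auto intro!: has_vector_derivative_fst d)
      moreover have "G (T, x) = G (0, x)" using per unfolding torus_periodic_def by (metis add_0)
      ultimately show ?thesis by (simp add: integral_unique)
    qed
    moreover have "integral (cbox 0 T) (\<lambda>t. integral (cbox 0 (2*pi)) (\<lambda>x. G' (t, x) (1, 0)))
       = integral (cbox 0 (2*pi)) (\<lambda>x. integral (cbox 0 T) (\<lambda>t. G' (t, x) (1, 0)))"
      by (rule integral_swap_continuous) (use cB[of "(1, 0)"] in \<open>simp add: case_prod_unfold\<close>)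
    ultimately show ?thesis by (simp add: integral_prod_continuous[OF cB])
  qed
  have "G' z v = fst v *\<^sub>R G' z (1, 0) + snd v *\<^sub>R G' z (0, 1)" for z
  proof -
    interpret bounded_linear "G' z" using d by (rule has_derivative_bounded_linear)
    have "v = fst v *\<^sub>R (1, 0) + snd v *\<^sub>R (0, 1)" by (simp add: prod_eq_iff)
    then show ?thesis by (metis add scaleR)
  qed
  moreover have "integral ?B (\<lambda>z. fst v *\<^sub>R G' z (1, 0) + snd v *\<^sub>R G' z (0, 1)) = 0"
    by (subst integral_add) (simp_all add: t x integrable_cmul integrable_continuous[OF cB])
  ultimately show ?thesis by presburger
qed

text \<open>Integration by parts without boundary terms: the derivative of \<open>f\<close> times
  the mode integrates to zero over the torus.\<close>

lemma fcoef_derivative: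
  assumes T: "T > 0" and d: "\<And>z. (f has_derivative f' z) (at z)"
    and c: "\<And>v. continuous_on UNIV (\<lambda>z. f' z v)" and per: "torus_periodic T f"
  shows "fcoef T m n (\<lambda>z. f' z v) = \<i> * of_real (freq T m n v) * fcoef T m n f"
proof -
  let ?E = "fmode T m n" and ?k = "\<lambda>v. of_real (freq T m n v) :: complex"
  have fc: "continuous_on S f" for S
    using d by (meson continuous_at_imp_continuous_on has_derivative_continuous)
  have fc': "continuous_on S (\<lambda>z. f' z v)" for S v using c continuous_on_subset by blast
  have "integral (cbox (0, 0) (T, 2 * pi)) (\<lambda>z. f z * (- \<i> * ?k v * ?E z) + f' z v * ?E z) = 0"
  proof (rule integral_torus_derivative_eq_0[OF T])
    show "((\<lambda>z. f z * ?E z) has_derivative (\<lambda>v. f z * (- \<i> * ?k v * ?E z) + f' z v * ?E z)) (at z)" for z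
      by (intro has_derivative_mult d fmode_has_derivative)
    show "torus_periodic T (\<lambda>z. f z * ?E z)"
      by (intro torus_periodic_mult per torus_periodic_fmode T)
  qed (intro continuous_intros fc fc')
  moreover have "integral (cbox (0, 0) (T, 2 * pi)) (\<lambda>z. f z * (- \<i> * ?k v * ?E z) + f' z v * ?E z)
     = (- \<i> * ?k v) * fcoef T m n f + fcoef T m n (\<lambda>z. f' z v)"
  proof -
    have "f z * (- \<i> * ?k v * ?E z) = (- \<i> * ?k v) * (f z * ?E z)" for z by (simp add: mult_ac)
    then show ?thesis unfolding fcoef_def
      by (simp only: integral_mult_right[symmetric])
        (rule integral_add; intro integrable_continuous continuous_intros fc fc')
  qed
  ultimately show ?thesis by (simp add: add_eq_0_iff2)
qed

lemma norm_fcoef_le: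
  assumes T: "T > 0" and c: "continuous_on UNIV f" and K: "\<And>z. norm (f z) \<le> K"
  shows "norm (fcoef T m n f) \<le> K * (2 * pi * T)"
proof -
  have "norm (fcoef T m n f) \<le> integral (cbox (0, 0) (T, 2 * pi)) (\<lambda>z. K)"
    unfolding fcoef_def
  proof (rule integral_norm_bound_integral)
    show "(\<lambda>z. f z * fmode T m n z) integrable_on cbox (0, 0) (T, 2 * pi)"
      by (intro integrable_continuous continuous_intros continuous_on_subset[OF c]) auto
  qed (use K in \<open>auto simp: norm_mult\<close>)
  also have "\<dots> = K * (2 * pi * T)"
    using T by (simp add: content_Pair)
  finally show ?thesis .
qed

text \<open>The circle estimate is applied twice: to the partial coefficient \<open>F n\<close> as a
  function of \<open>t\<close>, and then to \<open>f\<close> as a function of \<open>x\<close> with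
  the bound just obtained. This is where 25 = 5 * 5 comes from.\<close>

lemma fourier_sup_bound_2d:
  assumes T: "T > 0" and d: "\<And>z. (f has_derivative f' z) (at z)"
    and c: "\<And>v. continuous_on UNIV (\<lambda>z. f' z v)" and per: "torus_periodic T f"
    and B: "\<And>m n. (1 + (real_of_int m)\<^sup>2) * (1 + (real_of_int n)\<^sup>2) * norm (fcoef T m n f) \<le> B"
  shows "2 * pi * T * norm (f z) \<le> 25 * B"
proof -
  have fc: "continuous_on S f" for S
    using d by (meson continuous_at_imp_continuous_on has_derivative_continuous)
  have fc2: "continuous_on S (\<lambda>z. f (a z, b z))" if "continuous_on S a" "continuous_on S b" for S :: "'a::topological_space set" and a b
    using continuous_on_compose2[OF fc[of UNIV] continuous_on_Pair[OF that]] by auto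
  have fc': "continuous_on S (\<lambda>z. f' (a z, b z) v)" if "continuous_on S a" "continuous_on S b" for S :: "'a::topological_space set" and a b v
    using continuous_on_compose2[OF c continuous_on_Pair[OF that]] by auto
  define F where "F n t = integral (cbox 0 (2 * pi)) (\<lambda>x. f (t, x) * cis (- (of_int n * x)))" for n :: int and t
  have Fd: "(F n has_vector_derivative integral (cbox 0 (2 * pi)) (\<lambda>x. f' (t, x) (1, 0) * cis (- (of_int n * x)))) (at t)" for n t
    unfolding F_def
  proof (rule leibniz_rule_vector_derivative[where U=UNIV])
    show "((\<lambda>t. f (t, x) * cis (- (of_int n * x))) has_vector_derivative f' (t, x) (1, 0) * cis (- (of_int n * x))) (at t)" for t x
      by (intro has_vector_derivative_mult_left has_vector_derivative_fst d)
    show "(\<lambda>x. f (t, x) * cis (- (of_int n * x))) integrable_on cbox 0 (2 * pi)" for t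
      by (intro integrable_continuous continuous_intros fc2)
    show "continuous_on (UNIV \<times> cbox 0 (2 * pi)) (\<lambda>(t, x). f' (t, x) (1, 0) * cis (- (of_int n * x)))"
      unfolding case_prod_unfold by (intro continuous_intros fc')
  qed auto
  have coef: "integral {0..T} (\<lambda>t. F n t * cis (- (of_int m * (2 * pi / T) * t))) = fcoef T m n f" for m n
  proof -
    have "fcoef T m n f = integral (cbox 0 T) (\<lambda>t. integral (cbox 0 (2*pi)) (\<lambda>x. f (t, x) * fmode T m n (t, x)))"
      unfolding fcoef_def by (rule integral_prod_continuous) (intro continuous_intros fc)
    also have "\<dots> = integral {0..T} (\<lambda>t. F n t * cis (- (of_int m * (2 * pi / T) * t)))"
      unfolding F_def integral_mult_left[symmetric]
      by (simp add: fmode_def freq_def cis_mult mult.assoc add.commute)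
    finally show ?thesis by simp
  qed
  have pos: "1 + (real_of_int n)\<^sup>2 > 0" for n by (simp add: add_pos_nonneg)
  have FB: "T * norm (F n t) \<le> 5 * (B / (1 + (real_of_int n)\<^sup>2))" for n t
  proof (rule fourier_sup_bound_1d[OF T _ Fd])
    show "F n (t + T) = F n t" for t using per by (simp add: F_def torus_periodic_def)
    show "(1 + (real_of_int m)\<^sup>2) * norm (integral {0..T} (\<lambda>t. F n t * cis (- (of_int m * (2 * pi / T) * t)))) \<le> B / (1 + (real_of_int n)\<^sup>2)" for m
      unfolding coef using B[of m n] pos[of n] by (simp add: pos_le_divide_eq mult_ac)
  qed
  obtain t x where z: "z = (t, x)" by fastforce
  have "2 * pi * norm (f (t, x)) \<le> 5 * (5 * B / T)"
  proof (rule fourier_sup_bound_1d[OF _ _ has_vector_derivative_snd[OF d]])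
    show "f (t, x + 2 * pi) = f (t, x)" for x using per by (simp add: torus_periodic_def)
    show "(1 + (real_of_int m)\<^sup>2) * norm (integral {0..2*pi} (\<lambda>x. f (t, x) * cis (- (of_int m * (2 * pi / (2 * pi)) * x)))) \<le> 5 * B / T" for m
      using FB[of m t] pos[of m] T by (simp add: F_def pos_le_divide_eq mult_ac)
  qed simp
  then show ?thesis using T by (simp add: z field_simps)
qed

section \<open>Scalar linear equations with real coefficient\<close>

text \<open>Integrating factor: the derivative of \<open>exp (- l * (s - s1)) *\<^sub>R y s\<close>
  is dominated by that of an explicit scalar function. Both signs of \<open>l\<close> are covered,
  since for negative \<open>l\<close> the two factors on the right are both nonpositive.\<close>

lemma linear_ode_estimate:
  fixes y g :: "real \<Rightarrow> complex"
  assumes l: "l \<noteq> 0" and d: "\<And>s. (y has_vector_derivative (of_real l * y s + g s)) (at s)"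
    and G: "\<And>s. s \<ge> s1 \<Longrightarrow> norm (g s) \<le> G" and s: "s1 \<le> s"
  shows "norm (exp (- l * (s - s1)) *\<^sub>R y s - y s1) \<le> G / l * (1 - exp (- l * (s - s1)))"
proof (cases "s1 = s")
  case False
  then have lt: "s1 < s" using s by simp
  let ?h = "\<lambda>s. exp (- l * (s - s1)) *\<^sub>R y s" and ?p = "\<lambda>s. - G / l * exp (- l * (s - s1))"
  have ed: "((\<lambda>s. exp (- l * (s - s1))) has_real_derivative (- l * exp (- l * (s - s1)))) (at s)" for s
    by (auto intro!: derivative_eq_intros)
  have hd: "(?h has_vector_derivative (exp (- l * (s - s1)) *\<^sub>R g s)) (at s)" for s
    using has_vector_derivative_scaleR[OF ed d]
    by (rule has_vector_derivative_eq_rhs) (simp add: scaleR_conv_of_real algebra_simps)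
  have "(?p has_real_derivative (G * exp (- l * (s - s1)))) (at s)" for s
    using DERIV_cmult[OF ed, of "- G / l"] l by simp
  then have pd: "(?p has_vector_derivative (G * exp (- l * (s - s1)))) (at s)" for s
    by (simp add: has_real_derivative_iff_has_vector_derivative)
  have "norm (?h s - ?h s1) \<le> ?p s - ?p s1"
  proof (rule differentiable_bound_general[OF lt _ _ hd pd])
    show "continuous_on {s1..s} ?h"
      by (intro continuous_at_imp_continuous_on ballI has_vector_derivative_continuous[OF hd])
    show "continuous_on {s1..s} ?p"
      by (intro continuous_at_imp_continuous_on ballI has_vector_derivative_continuous[OF pd])
    show "norm (exp (- l * (x - s1)) *\<^sub>R g x) \<le> G * exp (- l * (x - s1))" if "s1 < x" for x
      using G[of x] that by simp
  qed
  then show ?thesis by (simp add: algebra_simps)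
qed simp

text \<open>The hypothesis on K excludes the exponentially growing solutions.\<close>
lemma linear_ode_unstable_bound:
  fixes y g :: "real \<Rightarrow> complex"
  assumes l: "l > 0" and d: "\<And>s. (y has_vector_derivative (of_real l * y s + g s)) (at s)"
    and G: "\<And>s. s \<ge> s1 \<Longrightarrow> norm (g s) \<le> G"
    and recur: "\<And>S. \<exists>s\<ge>S. norm (of_real l * y s + g s) < K"
  shows "norm (y s1) \<le> G / l"
proof (rule ccontr)
  assume neg: "\<not> ?thesis"
  \<comment> \<open>The excess of \<open>y\<close> over the size that bounded solutions can have; it
    is what grows exponentially.\<close>
  define \<delta> where "\<delta> = norm (y s1) - G / l"
  have \<delta>: "\<delta> > 0" using neg by (simp add: \<delta>_def)
  have G0: "G \<ge> 0" using G[of s1] norm_ge_zero[of "g s1"] by linarith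
  have grow: "norm (y s) \<ge> \<delta> * (1 + l * (s - s1))" if s: "s \<ge> s1" for s
  proof -
    have "G / l * (1 - exp (- l * (s - s1))) \<le> G / l"
      using G0 l by (intro mult_left_le) auto
    then have "norm (exp (- l * (s - s1)) *\<^sub>R y s) \<ge> \<delta>"
      using linear_ode_estimate[OF _ d G s] l norm_triangle_ineq3[of "exp (- l * (s - s1)) *\<^sub>R y s" "y s1"]
      unfolding \<delta>_def by simp
    then have "\<delta> \<le> norm (y s) / E" if "E = exp (l * (s - s1))" for E
      by (simp add: that exp_minus divide_inverse mult.commute)
    then have "\<delta> * E \<le> norm (y s)" if "E = exp (l * (s - s1))" for E
      using that exp_gt_zero[of "l * (s - s1)"] pos_le_divide_eq by metis
    then have "\<delta> * exp (l * (s - s1)) \<le> norm (y s)" by simp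
    moreover have "\<delta> * (1 + l * (s - s1)) \<le> \<delta> * exp (l * (s - s1))"
      using \<delta> by (intro mult_left_mono exp_ge_add_one_self) auto
    ultimately show ?thesis by linarith
  qed
  \<comment> \<open>From this time on the lower bound l * \<delta> * l * (s - s1) for the size of
    \<open>l * y\<close> is at least |K| + G, which contradicts a derivative smaller than
    \<open>K\<close>. The linear minorant of the exponential is enough for this.\<close>
  define S where "S = s1 + (\<bar>K\<bar> + G) / (l * l * \<delta>)"
  have "S \<ge> s1" using l \<delta> G0 by (simp add: S_def)
  obtain s where s: "s \<ge> S" "norm (of_real l * y s + g s) < K" using recur by blast
  have ss: "s \<ge> s1" using s \<open>S \<ge> s1\<close> by simp
  have "(\<bar>K\<bar> + G) / (l * l * \<delta>) \<le> s - s1" using s by (simp add: S_def)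
  then have "\<bar>K\<bar> + G \<le> l * (\<delta> * (l * (s - s1)))" using l \<delta> by (simp add: pos_divide_le_eq mult_ac)
  also have "\<dots> \<le> l * norm (y s)"
    using grow[OF ss] \<delta> l by (intro mult_left_mono) (auto simp: algebra_simps)
  also have "\<dots> = norm (of_real l * y s)" using l by (simp add: norm_mult)
  also have "\<dots> \<le> norm (of_real l * y s + g s) + norm (g s)"
    using norm_triangle_ineq4[of "of_real l * y s + g s" "g s"] by simp
  also have "\<dots> < K + G" using s(2) G[OF ss] by linarith
  finally show False by linarith
qed

lemma linear_ode_stable_bound:
  fixes y g :: "real \<Rightarrow> complex"
  assumes l: "l < 0" and d: "\<And>s. (y has_vector_derivative (of_real l * y s + g s)) (at s)"
    and G: "\<And>s. s \<ge> s1 \<Longrightarrow> norm (g s) \<le> G" and s: "s1 \<le> s"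
  shows "norm (y s) \<le> exp (l * (s - s1)) * norm (y s1) + G / \<bar>l\<bar>"
proof -
  have G0: "G \<ge> 0" using G[of s1] norm_ge_zero[of "g s1"] by linarith
  define E where "E = exp (l * (s - s1))"
  have E: "E > 0" by (simp add: E_def)
  have "norm (inverse E *\<^sub>R y s - y s1) \<le> G / l * (1 - inverse E)"
    using linear_ode_estimate[OF _ d G s] l by (simp add: E_def exp_minus)
  then have "inverse E * norm (y s) \<le> norm (y s1) + G / l * (1 - inverse E)"
    using norm_triangle_ineq2[of "inverse E *\<^sub>R y s" "y s1"] E by simp
  then have "E * (inverse E * norm (y s)) \<le> E * (norm (y s1) + G / l * (1 - inverse E))"
    using E by (intro mult_left_mono) auto
  also have "E * (inverse E * norm (y s)) = norm (y s)" using E by simp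
  also have "E * (norm (y s1) + G / l * (1 - inverse E)) = E * norm (y s1) + G / l * E - G / l"
    using E by (simp add: algebra_simps)
  also have "\<dots> \<le> E * norm (y s1) + G / \<bar>l\<bar>"
  proof -
    have "G / l * E \<le> 0" using G0 l E by (simp add: divide_nonneg_neg mult_nonpos_nonneg)
    then show ?thesis using l by simp
  qed
  finally show ?thesis by (simp add: E_def)
qed

text \<open>In the unstable case the bound \<open>G / l\<close> is obtained by taking
  \<open>s\<close> itself as the starting time. \<open>K\<close> does not occur in the conclusion:
  it excludes growth qualitatively and may depend on the mode without spoiling uniformity over the
  modes.\<close>

lemma linear_ode_bound:
  fixes y g :: "real \<Rightarrow> complex"
  assumes l: "l \<noteq> 0" and d: "\<And>s. (y has_vector_derivative (of_real l * y s + g s)) (at s)"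
    and G: "\<And>s. s \<ge> s1 \<Longrightarrow> norm (g s) \<le> G"
    and recur: "\<And>S. \<exists>s\<ge>S. norm (of_real l * y s + g s) < K" and s: "s1 \<le> s"
  shows "norm (y s) \<le> norm (y s1) + G / \<bar>l\<bar>"
proof (cases "l > 0")
  case True
  have "norm (y s) \<le> G / l"
    by (rule linear_ode_unstable_bound[OF True d _ recur]) (use G s in auto)
  then show ?thesis using True by (simp add: add_increasing)
next
  case False
  then have "l < 0" using l by simp
  have "exp (l * (s - s1)) * norm (y s1) \<le> norm (y s1)"
    using \<open>l < 0\<close> s by (intro mult_left_le_one_le) (auto simp: mult_nonpos_nonneg)
  then show ?thesis using linear_ode_stable_bound[OF \<open>l < 0\<close> d G s] by linarith
qed

text \<open>Subtracting the equilibrium \<open>- g1 / l\<close> turns the forcing into one tending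
  to zero and leaves the derivative, hence the recurrence hypothesis, unchanged. An unstable
  solution is then bounded by the forcing on its future; a stable one forgets its initial value
  exponentially.\<close>

lemma linear_ode_tendsto:
  fixes y g :: "real \<Rightarrow> complex"
  assumes l: "l \<noteq> 0" and d: "\<And>s. (y has_vector_derivative (of_real l * y s + g s)) (at s)"
    and lim: "(g \<longlongrightarrow> g1) at_top"
    and recur: "\<And>S. \<exists>s\<ge>S. norm (of_real l * y s + g s) < K"
  shows "(y \<longlongrightarrow> - g1 / of_real l) at_top"
proof -
  define z where "z s = y s + g1 / of_real l" for s
  define k where "k s = g s - g1" for s
  have eq: "of_real l * z s + k s = of_real l * y s + g s" for s
    using l by (simp add: z_def k_def field_simps)
  have zd: "(z has_vector_derivative (of_real l * z s + k s)) (at s)" for s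
    unfolding eq unfolding z_def[abs_def] by (simp only: has_vector_derivative_add_const d)
  have recur': "\<exists>s\<ge>S. norm (of_real l * z s + k s) < K" for S unfolding eq by (rule recur)
  have klim: "\<exists>S. \<forall>s\<ge>S. norm (k s) \<le> e" if "e > 0" for e
    using tendstoD[OF lim that] unfolding eventually_at_top_linorder k_def dist_norm by (meson less_imp_le)
  have "(z \<longlongrightarrow> 0) at_top"
  proof (rule tendstoI)
    fix e :: real assume e: "e > 0"
    then have "\<bar>l\<bar> * (e / 2) > 0" using l by simp
    from klim[OF this] obtain S where S: "\<And>s. s \<ge> S \<Longrightarrow> norm (k s) \<le> \<bar>l\<bar> * (e / 2)" by blast
    show "\<forall>\<^sub>F s in at_top. dist (z s) 0 < e"
    proof (cases "l > 0")
      case True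
      have "norm (z s) \<le> \<bar>l\<bar> * (e / 2) / l" if "s \<ge> S" for s
        by (rule linear_ode_unstable_bound[OF True zd _ recur']) (use S that in auto)
      then have "dist (z s) 0 < e" if "s \<ge> S" for s using that True e by fastforce
      then show ?thesis unfolding eventually_at_top_linorder by blast
    next
      case False
      then have l0: "l < 0" using l by simp
      have "filterlim (\<lambda>s. l * (s - S)) at_bot at_top"
        by (rule filterlim_tendsto_neg_mult_at_bot[OF tendsto_const l0])
          (use filterlim_tendsto_add_at_top[OF tendsto_const[of "- S"] filterlim_ident] in simp)
      then have "((\<lambda>s. exp (l * (s - S))) \<longlongrightarrow> 0) at_top"
        by (rule filterlim_compose[OF exp_at_bot])
      then have "((\<lambda>s. exp (l * (s - S)) * norm (z S)) \<longlongrightarrow> 0 * norm (z S)) at_top"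
        by (intro tendsto_mult tendsto_const)
      then have "\<forall>\<^sub>F s in at_top. exp (l * (s - S)) * norm (z S) < e / 2"
        by (rule order_tendstoD(2)) (use e in simp)
      then show ?thesis using eventually_ge_at_top[of S]
      proof eventually_elim
        case (elim s)
        have "norm (z s) \<le> exp (l * (s - S)) * norm (z S) + \<bar>l\<bar> * (e / 2) / \<bar>l\<bar>"
          by (rule linear_ode_stable_bound[OF l0 zd S elim(2)])
        then show ?case using elim(1) l by simp
      qed
    qed
  qed
  then have "((\<lambda>s. z s - g1 / of_real l) \<longlongrightarrow> 0 - g1 / of_real l) at_top"
    by (intro tendsto_diff tendsto_const)
  then show ?thesis by (simp add: z_def)
qed

section \<open>Uniform derivative bounds and decay of Fourier coefficients\<close>

text \<open>A family version of \<open>Ck\<close> with bounds uniform in the parameter and in space.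
  The parameter set is explicit because the forcing is controlled only on late half-lines
  \<open>{S..}\<close>, while initial data are treated with a singleton.\<close>

fun Ckb :: "nat \<Rightarrow> 's set \<Rightarrow> ('s \<Rightarrow> 'a::euclidean_space \<Rightarrow> 'b::real_normed_vector) \<Rightarrow> bool" where
  "Ckb 0 S F = ((\<forall>s\<in>S. continuous_on UNIV (F s)) \<and> (\<exists>K. \<forall>s\<in>S. \<forall>x. norm (F s x) \<le> K))"
| "Ckb (Suc k) S F = (Ckb 0 S F \<and> (\<exists>F'. (\<forall>s\<in>S. \<forall>x. (F s has_derivative F' s x) (at x)) \<and>
      (\<forall>v. Ckb k S (\<lambda>s x. F' s x v))))"

lemma Ckb_0: "Ckb k S F \<Longrightarrow> Ckb 0 S F"
  by (cases k) auto

lemma Ckb_SucE: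
  assumes "Ckb (Suc k) S F"
  obtains F' where "\<And>s x. s \<in> S \<Longrightarrow> (F s has_derivative F' s x) (at x)" "\<And>v. Ckb k S (\<lambda>s x. F' s x v)"
  using assms unfolding Ckb.simps by blast

lemma Ckb_SucI:
  assumes "Ckb 0 S F" "\<And>s x. s \<in> S \<Longrightarrow> (F s has_derivative F' s x) (at x)" "\<And>v. Ckb k S (\<lambda>s x. F' s x v)"
  shows "Ckb (Suc k) S F"
  unfolding Ckb.simps(2) using assms by (intro conjI exI[of _ F']) blast+

lemma Ckb_Suc: "Ckb (Suc k) S F \<Longrightarrow> Ckb k S F"
proof (induction k arbitrary: F)
  case (Suc k)
  obtain F' where F': "\<And>s x. s \<in> S \<Longrightarrow> (F s has_derivative F' s x) (at x)"
    "\<And>v. Ckb (Suc k) S (\<lambda>s x. F' s x v)" using Ckb_SucE[OF Suc.prems] by blast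
  have "Ckb k S (\<lambda>s x. F' s x v)" for v using Suc.IH[OF F'(2)] .
  then show ?case using F'(1) Ckb_0[OF Suc.prems] by (intro Ckb_SucI)
qed (auto dest: Ckb_0)

lemma Ckb_add: "Ckb k S F \<Longrightarrow> Ckb k S G \<Longrightarrow> Ckb k S (\<lambda>s x. F s x + G s x)"
proof (induction k arbitrary: F G)
  case 0
  obtain K L where K: "\<forall>s\<in>S. \<forall>x. norm (F s x) \<le> K" and L: "\<forall>s\<in>S. \<forall>x. norm (G s x) \<le> L"
    using 0 by auto
  have "norm (F s x + G s x) \<le> K + L" if "s \<in> S" for s x
    using K L that norm_triangle_mono by blast
  then show ?case using 0 by (auto intro: continuous_on_add)
next
  case (Suc k)
  obtain F' where F': "\<And>s x. s \<in> S \<Longrightarrow> (F s has_derivative F' s x) (at x)"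
    "\<And>v. Ckb k S (\<lambda>s x. F' s x v)" using Ckb_SucE[OF Suc.prems(1)] by blast
  obtain G' where G': "\<And>s x. s \<in> S \<Longrightarrow> (G s has_derivative G' s x) (at x)"
    "\<And>v. Ckb k S (\<lambda>s x. G' s x v)" using Ckb_SucE[OF Suc.prems(2)] by blast
  have "Ckb k S (\<lambda>s x. F s x + G s x)" using Suc.IH[OF Ckb_Suc[OF Suc.prems(1)] Ckb_Suc[OF Suc.prems(2)]] .
  then have "Ckb 0 S (\<lambda>s x. F s x + G s x)" by (rule Ckb_0)
  moreover have "((\<lambda>x. F s x + G s x) has_derivative (\<lambda>v. F' s x v + G' s x v)) (at x)" if "s \<in> S" for s x
    using F'(1) G'(1) that by (intro has_derivative_add)
  moreover have "Ckb k S (\<lambda>s x. F' s x v + G' s x v)" for v using Suc.IH[OF F'(2) G'(2)] .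
  ultimately show ?case by (rule Ckb_SucI)
qed

lemma Ckb_scaleR: "Ckb k S a \<Longrightarrow> Ckb k S F \<Longrightarrow> Ckb k S (\<lambda>s x. a s x *\<^sub>R F s x)"
proof (induction k arbitrary: a F)
  case 0
  obtain K L where K: "\<forall>s\<in>S. \<forall>x. norm (a s x) \<le> K" and L: "\<forall>s\<in>S. \<forall>x. norm (F s x) \<le> L"
    using 0 by auto
  have "norm (a s x *\<^sub>R F s x) \<le> \<bar>K\<bar> * \<bar>L\<bar>" if "s \<in> S" for s x
  proof -
    have "norm (a s x) \<le> \<bar>K\<bar>" "norm (F s x) \<le> \<bar>L\<bar>" using K L that by (meson abs_ge_self order_trans)+
    then show ?thesis by (simp add: mult_mono)
  qed
  then show ?case using 0 by (auto intro: continuous_on_scaleR)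
next
  case (Suc k)
  obtain a' where a': "\<And>s x. s \<in> S \<Longrightarrow> (a s has_derivative a' s x) (at x)"
    "\<And>v. Ckb k S (\<lambda>s x. a' s x v)" using Ckb_SucE[OF Suc.prems(1)] by blast
  obtain F' where F': "\<And>s x. s \<in> S \<Longrightarrow> (F s has_derivative F' s x) (at x)"
    "\<And>v. Ckb k S (\<lambda>s x. F' s x v)" using Ckb_SucE[OF Suc.prems(2)] by blast
  have "Ckb k S (\<lambda>s x. a s x *\<^sub>R F s x)" using Suc.IH[OF Ckb_Suc[OF Suc.prems(1)] Ckb_Suc[OF Suc.prems(2)]] .
  then have "Ckb 0 S (\<lambda>s x. a s x *\<^sub>R F s x)" by (rule Ckb_0)
  moreover have "((\<lambda>x. a s x *\<^sub>R F s x) has_derivative (\<lambda>v. a s x *\<^sub>R F' s x v + a' s x v *\<^sub>R F s x)) (at x)" if "s \<in> S" for s x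
    using a'(1) F'(1) that by (intro has_derivative_scaleR)
  moreover have "Ckb k S (\<lambda>s x. a s x *\<^sub>R F' s x v + a' s x v *\<^sub>R F s x)" for v
    using Ckb_add[OF Suc.IH[OF Ckb_Suc[OF Suc.prems(1)] F'(2)] Suc.IH[OF a'(2) Ckb_Suc[OF Suc.prems(2)]]] .
  ultimately show ?case by (rule Ckb_SucI)
qed

text \<open>Each available derivative buys one power of the weight: a derivative in direction (1, 0)
  or (0, 1) multiplies the coefficient by a constant times \<open>m\<close> or by
  \<open>n\<close>.\<close>

lemma fcoef_decay:
  assumes T: "T > 0" and "Ckb k S F" and "\<And>s. s \<in> S \<Longrightarrow> torus_periodic T (F s)"
  shows "\<exists>K. \<forall>s\<in>S. \<forall>m n. (1 + \<bar>real_of_int m\<bar> + \<bar>real_of_int n\<bar>) ^ k * norm (fcoef T m n (F s)) \<le> K"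
  using assms(2,3)
proof (induction k arbitrary: F)
  case 0
  obtain K where "\<And>s x. s \<in> S \<Longrightarrow> norm (F s x) \<le> K" using 0 unfolding Ckb.simps by blast
  then have "norm (fcoef T m n (F s)) \<le> K * (2 * pi * T)" if "s \<in> S" for s m n
    using norm_fcoef_le[OF T] 0 that by simp
  then show ?case by auto
next
  case (Suc k)
  let ?W = "\<lambda>m n. 1 + \<bar>real_of_int m\<bar> + \<bar>real_of_int n\<bar>"
  obtain F' where F': "\<And>s x. s \<in> S \<Longrightarrow> (F s has_derivative F' s x) (at x)"
    "\<And>v. Ckb k S (\<lambda>s x. F' s x v)" using Ckb_SucE[OF Suc.prems(1)] by blast
  have cont: "continuous_on UNIV (\<lambda>x. F' s x v)" if "s \<in> S" for s v
    using Ckb_0[OF F'(2)] that by simp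
  have per: "torus_periodic T (\<lambda>x. F' s x v)" if "s \<in> S" for s v
    by (rule torus_periodic_derivative[OF Suc.prems(2)[OF that] F'(1)[OF that]])
  have dec: "\<exists>K. \<forall>s\<in>S. \<forall>m n. ?W m n ^ k * (\<bar>freq T m n v\<bar> * norm (fcoef T m n (F s))) \<le> K" for v
  proof -
    obtain K where K: "\<And>s m n. s \<in> S \<Longrightarrow> ?W m n ^ k * norm (fcoef T m n (\<lambda>x. F' s x v)) \<le> K"
      using Suc.IH[OF F'(2) per] by blast
    have "?W m n ^ k * (\<bar>freq T m n v\<bar> * norm (fcoef T m n (F s))) \<le> K" if "s \<in> S" for s m n
      using K[OF that, of m n] fcoef_derivative[OF T F'(1)[OF that] cont[OF that] Suc.prems(2)[OF that], of m n v]
      by (simp add: norm_mult)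
    then show ?thesis by blast
  qed
  obtain K0 where K0: "\<And>s m n. s \<in> S \<Longrightarrow> ?W m n ^ k * norm (fcoef T m n (F s)) \<le> K0"
    using Suc.IH[OF Ckb_Suc[OF Suc.prems(1)] Suc.prems(2)] by blast
  obtain K1 where K1: "\<And>s m n. s \<in> S \<Longrightarrow> ?W m n ^ k * (\<bar>freq T m n (1, 0)\<bar> * norm (fcoef T m n (F s))) \<le> K1"
    using dec by blast
  obtain K2 where K2: "\<And>s m n. s \<in> S \<Longrightarrow> ?W m n ^ k * (\<bar>freq T m n (0, 1)\<bar> * norm (fcoef T m n (F s))) \<le> K2"
    using dec by blast
  \<comment> \<open>The three summands of the weight 1 + |m| + |n| are paid for by
    \<open>K0\<close>, \<open>K1\<close> and \<open>K2\<close>; the factor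
    \<open>T / (2 * pi)\<close> undoes the frequency unit in the t-direction.\<close>
  have "?W m n ^ Suc k * norm (fcoef T m n (F s)) \<le> K0 + T / (2 * pi) * K1 + K2" if "s \<in> S" for s m n
  proof -
    define C where "C = ?W m n ^ k * norm (fcoef T m n (F s))"
    have "T / (2 * pi) * (\<bar>freq T m n (1, 0)\<bar> * C) \<le> T / (2 * pi) * K1"
      using K1[OF that, of m n] T by (intro mult_left_mono) (auto simp: C_def mult_ac)
    moreover have "T / (2 * pi) * (\<bar>freq T m n (1, 0)\<bar> * C) = \<bar>real_of_int m\<bar> * C"
      using T by (simp add: freq_def abs_mult)
    moreover have "\<bar>real_of_int n\<bar> * C \<le> K2"
      using K2[OF that, of m n] by (simp add: C_def freq_def mult_ac)
    moreover have "C \<le> K0" using K0[OF that, of m n] by (simp add: C_def)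
    moreover have "?W m n ^ Suc k * norm (fcoef T m n (F s)) = C + \<bar>real_of_int m\<bar> * C + \<bar>real_of_int n\<bar> * C"
      by (simp add: C_def algebra_simps)
    ultimately show ?thesis by linarith
  qed
  then show ?case by blast
qed

section \<open>Boundedness of continuous periodic functions\<close>

lemma continuous_periodic_bounded:
  fixes f :: "real \<Rightarrow> 'a::real_normed_vector"
  assumes P: "P > 0" and c: "continuous_on UNIV f" and per: "\<And>t. f (t + P) = f t"
  shows "\<exists>K. \<forall>t. norm (f t) \<le> K"
proof -
  interpret periodic_fun_simple f P by standard (rule per)
  have "compact (f ` {0..P})"
    by (intro compact_continuous_image continuous_on_subset[OF c]) auto
  from compact_imp_bounded[OF this] obtain K where K: "\<forall>x\<in>f ` {0..P}. norm x \<le> K"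
    unfolding bounded_iff by blast
  have "norm (f t) \<le> K" for t
  proof -
    define t' where "t' = t - of_int \<lfloor>t / P\<rfloor> * P"
    have "t' \<in> {0..P}"
      using floor_divide_lower[OF P, of t] floor_divide_upper[OF P, of t] by (simp add: t'_def algebra_simps)
    moreover have "f t' = f t" by (simp add: t'_def minus_of_int)
    ultimately show ?thesis using K by (metis imageI)
  qed
  then show ?thesis by blast
qed

lemma continuous_torus_periodic_bounded:
  fixes f :: "real \<times> real \<Rightarrow> 'a::real_normed_vector"
  assumes T: "T > 0" and c: "continuous_on UNIV f" and per: "torus_periodic T f"
  shows "\<exists>K. \<forall>z. norm (f z) \<le> K"
proof -
  have "compact (f ` cbox (0, 0) (T, 2 * pi))"
    by (intro compact_continuous_image continuous_on_subset[OF c]) auto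
  from compact_imp_bounded[OF this] obtain K where K: "\<forall>x\<in>f ` cbox (0, 0) (T, 2 * pi). norm x \<le> K"
    unfolding bounded_iff by blast
  have "norm (f (t, x)) \<le> K" for t x
  proof -
    interpret t: periodic_fun_simple "\<lambda>t. f (t, x1)" T for x1
      by standard (use per in \<open>simp add: torus_periodic_def\<close>)
    interpret x: periodic_fun_simple "\<lambda>x. f (t1, x)" "2 * pi" for t1
      by standard (use per in \<open>simp add: torus_periodic_def\<close>)
    define t' where "t' = t - of_int \<lfloor>t / T\<rfloor> * T"
    have t': "0 \<le> t'" "t' \<le> T"
      using floor_divide_lower[OF T, of t] floor_divide_upper[OF T, of t] by (simp_all add: t'_def algebra_simps)
    define x' where "x' = x - of_int \<lfloor>x / (2 * pi)\<rfloor> * (2 * pi)"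
    have x': "0 \<le> x'" "x' \<le> 2 * pi"
      using floor_divide_lower[of "2 * pi" x] floor_divide_upper[of "2 * pi" x] by (simp_all add: x'_def algebra_simps)
    have "f (t', x') = f (t, x)" unfolding t'_def x'_def by (simp only: t.minus_of_int x.minus_of_int)
    moreover have "(t', x') \<in> cbox (0, 0) (T, 2 * pi)" using t' x' by auto
    ultimately show ?thesis using K by (metis imageI)
  qed
  then show ?thesis by (metis prod.collapse)
qed

lemma Ckb_smooth_torus_periodic:
  assumes T: "T > 0" and "smooth f" and "torus_periodic T f"
  shows "Ckb k S (\<lambda>_. f)"
  using assms(2,3)
proof (induction k arbitrary: f)
  case 0
  then show ?case
    using continuous_torus_periodic_bounded[OF T smooth_continuous_on] smooth_continuous_on
    unfolding Ckb.simps by blast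
next
  case (Suc k)
  note d = smooth_has_derivative[OF Suc.prems(1)]
  show ?case
  proof (rule Ckb_SucI[OF _ d])
    show "Ckb 0 S (\<lambda>_. f)" using Ckb_0[OF Suc.IH[OF Suc.prems]] .
    show "Ckb k S (\<lambda>s x. pd v f x)" for v
      using Suc.IH[OF smooth_pd[OF Suc.prems(1)] torus_periodic_derivative[OF Suc.prems(2) d]] .
  qed
qed

lemma torus_periodic_pd: "smooth f \<Longrightarrow> torus_periodic T f \<Longrightarrow> torus_periodic T (pd v f)"
  using torus_periodic_derivative[OF _ smooth_has_derivative] by blast

lemma torus_periodic_foldr_pd: "smooth f \<Longrightarrow> torus_periodic T f \<Longrightarrow> torus_periodic T (foldr pd w f)"
  by (induction w) (auto intro: torus_periodic_pd smooth_foldr_pd)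

section \<open>Iterated one-variable derivatives as words of directional derivatives\<close>

lemma smooth_line_has_vector_derivative:
  assumes "smooth f"
  shows "((\<lambda>r. f (r *\<^sub>R v + c)) has_vector_derivative pd v f (r *\<^sub>R v + c)) (at r)"
proof -
  interpret bounded_linear "\<lambda>w. pd w f (r *\<^sub>R v + c)"
    using smooth_has_derivative[OF assms] by (rule has_derivative_bounded_linear)
  have "((\<lambda>r. r *\<^sub>R v + c) has_derivative (\<lambda>h. h *\<^sub>R v)) (at r)"
    by (auto intro!: derivative_eq_intros)
  from has_derivative_compose[OF this smooth_has_derivative[OF assms]]
  show ?thesis by (simp add: has_vector_derivative_def scaleR)
qed

lemma dD_line: "smooth f \<Longrightarrow> dD (\<lambda>r. f (r *\<^sub>R v + c)) r = pd v f (r *\<^sub>R v + c)"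
  unfolding dD_def by (rule vector_derivative_at[OF smooth_line_has_vector_derivative])

lemma dD_smooth: "smooth f \<Longrightarrow> dD f = pd 1 f"
  using dD_line[of f 1 0] by auto

lemma smooth_funpow_dD: "smooth f \<Longrightarrow> smooth ((dD ^^ k) f)"
  by (induction k) (auto simp: dD_smooth smooth_pd)

lemma funpow_dD_linear_comp:
  assumes "smooth f" "bounded_linear L"
  shows "(dD ^^ k) (\<lambda>t. L (f t)) = (\<lambda>t. L ((dD ^^ k) f t))"
proof (induction k)
  case (Suc k)
  have sm: "smooth ((dD ^^ k) f)" by (rule smooth_funpow_dD[OF assms(1)])
  show ?case
    using pd_linear_comp[OF sm assms(2)] smooth_linear_comp[OF sm assms(2)] by (simp add: Suc dD_smooth sm)
qed simp

text \<open>Connects the mixed derivatives of the final statement with words. The x-directions stand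
  at the end of the list because \<open>foldr\<close> applies the last entry first and
  \<open>Dtx\<close> differentiates in \<open>x\<close> first.\<close>

lemma Dtx_eq_foldr_pd:
  assumes "smooth (\<lambda>(t, x). g t x)"
  shows "Dtx j k g t x = foldr pd (replicate j (1, 0) @ replicate k (0, 1)) (\<lambda>(t, x). g t x) (t, x)"
proof -
  let ?g = "\<lambda>(t, x). g t x"
  have x: "(dD ^^ k) (\<lambda>x. f (t, x)) = (\<lambda>x. foldr pd (replicate k (0, 1)) f (t, x))"
    if "smooth f" for f :: "real \<times> real \<Rightarrow> 'a" and t
  proof (induction k)
    case (Suc k)
    show ?case
      using dD_line[OF smooth_foldr_pd[OF that, of "replicate k (0, 1)"], of "(0, 1)" "(t, 0)"] by (simp add: Suc fun_eq_iff)
  qed simp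
  have t: "(dD ^^ j) (\<lambda>t. f (t, x)) = (\<lambda>t. foldr pd (replicate j (1, 0)) f (t, x))"
    if "smooth f" for f :: "real \<times> real \<Rightarrow> 'a" and x
  proof (induction j)
    case (Suc j)
    show ?case
      using dD_line[OF smooth_foldr_pd[OF that, of "replicate j (1, 0)"], of "(1, 0)" "(0, x)"] by (simp add: Suc fun_eq_iff)
  qed simp
  have "Dtx j k g t x = (dD ^^ j) (\<lambda>t'. (dD ^^ k) (\<lambda>x'. ?g (t', x')) x) t" by (simp add: Dtx_def)
  also have "\<dots> = (dD ^^ j) (\<lambda>t'. foldr pd (replicate k (0, 1)) ?g (t', x)) t"
    by (simp only: x[OF assms])
  also have "\<dots> = foldr pd (replicate j (1, 0)) (foldr pd (replicate k (0, 1)) ?g) (t, x)"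
    by (simp only: t[OF smooth_foldr_pd[OF assms]])
  finally show ?thesis by simp
qed

text \<open>The interval has half-width 2 pi - r > pi, so it reaches past the seams of the
  reduction. If the reduction picks another period \<open>j\<close>, both representatives lie
  outside the support and both values vanish.\<close>

lemma rho_S1_eq:
  assumes r: "r < pi" and supp: "\<And>y. \<bar>y\<bar> > r \<Longrightarrow> \<rho> y = 0" and y: "\<bar>y - 2 * pi * of_int k\<bar> < 2 * pi - r"
  shows "rho_S1 \<rho> y = \<rho> (y - 2 * pi * of_int k)"
proof -
  define j where "j = \<lfloor>(y + pi) / (2 * pi)\<rfloor>"
  have j: "\<bar>y - 2 * pi * of_int j\<bar> \<le> pi"
    using floor_divide_lower[of "2 * pi" "y + pi"] floor_divide_upper[of "2 * pi" "y + pi"]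
    unfolding j_def by (simp add: algebra_simps abs_le_iff)
  show ?thesis
  proof (cases "j = k")
    case False
    then have "1 \<le> \<bar>real_of_int j - of_int k\<bar>" by linarith
    then have "2 * pi \<le> 2 * pi * \<bar>real_of_int j - of_int k\<bar>" by simp
    also have "\<dots> = \<bar>2 * pi * of_int j - 2 * pi * of_int k\<bar>" by (simp add: abs_mult right_diff_distrib[symmetric])
    finally have "\<bar>y - 2 * pi * of_int j\<bar> > r" "\<bar>y - 2 * pi * of_int k\<bar> > r" using j y r by linarith+
    then show ?thesis using supp by (simp add: rho_S1_def j_def)
  qed (simp add: rho_S1_def j_def)
qed

lemma rho_S1_periodic: "rho_S1 \<rho> (y + 2 * pi) = rho_S1 \<rho> y"
proof -
  have "(y + 2 * pi + pi) / (2 * pi) = (y + pi) / (2 * pi) + 1" by (simp add: field_simps)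
  then have "\<lfloor>(y + 2 * pi + pi) / (2 * pi)\<rfloor> = \<lfloor>(y + pi) / (2 * pi)\<rfloor> + 1" by simp
  then show ?thesis by (simp add: rho_S1_def algebra_simps)
qed

text \<open>Every point has a neighbourhood, even at a seam, on which the periodic extension is a
  single translate of \<open>\<rho>\<close>. Differentiation therefore commutes with the extension,
  and the derivative of \<open>\<rho>\<close> again vanishes beyond \<open>r\<close>, which closes
  the coinduction.\<close>

lemma smooth_rho_S1:
  assumes r: "r < pi" and supp: "\<And>y. \<bar>y\<bar> > r \<Longrightarrow> \<rho> y = 0" and sm: "smooth \<rho>"
  shows "smooth (rho_S1 \<rho>)"
proof (rule smooth_coinduct[where P="\<lambda>g. \<exists>\<rho>. smooth \<rho> \<and> (\<forall>y. \<bar>y\<bar> > r \<longrightarrow> \<rho> y = 0) \<and> g = rho_S1 \<rho>"])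
  fix g assume "\<exists>\<rho>. smooth \<rho> \<and> (\<forall>y. \<bar>y\<bar> > r \<longrightarrow> \<rho> y = 0) \<and> g = rho_S1 \<rho>"
  then obtain \<rho> where sm: "smooth \<rho>" and supp: "\<And>y. \<bar>y\<bar> > r \<Longrightarrow> \<rho> y = 0" and g: "g = rho_S1 \<rho>" by blast
  have supp': "pd v \<rho> y = 0" if "\<bar>y\<bar> > r" for v y
  proof -
    have "(\<rho> has_derivative (\<lambda>v. 0)) (at y)"
    proof (rule has_derivative_transform_within_open[OF has_derivative_const])
      show "open {y::real. \<bar>y\<bar> > r}" by (intro open_Collect_less continuous_intros)
    qed (use that supp in auto)
    then show ?thesis by (rule pd_eq)
  qed
  have "(rho_S1 \<rho> has_derivative (\<lambda>v. rho_S1 (pd v \<rho>) y)) (at y)" for y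
  proof -
    define k where "k = \<lfloor>(y + pi) / (2 * pi)\<rfloor>"
    have "\<bar>y - 2 * pi * of_int k\<bar> \<le> pi"
    using floor_divide_lower[of "2 * pi" "y + pi"] floor_divide_upper[of "2 * pi" "y + pi"]
    unfolding k_def by (simp add: algebra_simps abs_le_iff)
    then have y: "\<bar>y - 2 * pi * of_int k\<bar> < 2 * pi - r" using r by linarith
    have "((\<lambda>y. y - 2 * pi * of_int k) has_derivative (\<lambda>v. v)) (at y)" by (auto intro!: derivative_eq_intros)
    from has_derivative_compose[OF this smooth_has_derivative[OF sm]]
    have "((\<lambda>y. \<rho> (y - 2 * pi * of_int k)) has_derivative (\<lambda>v. pd v \<rho> (y - 2 * pi * of_int k))) (at y)" .
    then have "(rho_S1 \<rho> has_derivative (\<lambda>v. pd v \<rho> (y - 2 * pi * of_int k))) (at y)"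
    proof (rule has_derivative_transform_within_open)
      show "open {y. \<bar>y - 2 * pi * of_int k\<bar> < 2 * pi - r}" by (intro open_Collect_less continuous_intros)
    qed (use y rho_S1_eq[OF r supp] in auto)
    moreover have "pd v \<rho> (y - 2 * pi * of_int k) = rho_S1 (pd v \<rho>) y" for v
      using rho_S1_eq[OF r supp' y] by simp
    ultimately show ?thesis by simp
  qed
  moreover have "\<exists>\<rho>'. smooth \<rho>' \<and> (\<forall>y. \<bar>y\<bar> > r \<longrightarrow> \<rho>' y = 0) \<and> (\<lambda>x. rho_S1 (pd v \<rho>) x) = rho_S1 \<rho>'" for v
    using smooth_pd[OF sm] supp' by (intro exI[of _ "pd v \<rho>"]) auto
  ultimately show "\<exists>g'. (\<forall>x. (g has_derivative g' x) (at x)) \<and>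
      (\<forall>v. \<exists>\<rho>. smooth \<rho> \<and> (\<forall>y. \<bar>y\<bar> > r \<longrightarrow> \<rho> y = 0) \<and> (\<lambda>x. g' x v) = rho_S1 \<rho>)"
    unfolding g by (intro exI[of _ "\<lambda>x v. rho_S1 (pd v \<rho>) x"]) auto
qed (use assms in auto)

text \<open>Bounds are assumed for the derivatives of \<open>\<theta>\<close> but not for
  \<open>\<theta>\<close>, which in the application is a real lift of an angle and unbounded.
  Periodicity of \<open>\<psi>\<close> supplies the bound of order zero.\<close>

lemma Ckb_periodic_comp:
  fixes \<psi> :: "real \<Rightarrow> 'b::real_normed_vector" and \<theta> :: "'s \<Rightarrow> 'a::euclidean_space \<Rightarrow> real"
  assumes d: "\<And>s z. s \<in> S \<Longrightarrow> (\<theta> s has_derivative \<theta>' s z) (at z)"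
    and "\<And>v. Ckb k S (\<lambda>s z. \<theta>' s z v)"
    and "smooth \<psi>" and P: "P > 0" and "\<And>y. \<psi> (y + P) = \<psi> y"
  shows "Ckb k S (\<lambda>s z. \<psi> (\<theta> s z))"
  using assms(2,3,5)
proof (induction k arbitrary: \<psi>)
  case 0
  obtain K where K: "\<And>y. norm (\<psi> y) \<le> K"
    using continuous_periodic_bounded[OF P smooth_continuous_on[OF 0(2)] 0(3)] by blast
  have "continuous_on UNIV (\<lambda>z. \<psi> (\<theta> s z))" if "s \<in> S" for s
  proof (rule continuous_on_compose2[OF smooth_continuous_on[OF 0(2)]])
    show "continuous_on UNIV (\<theta> s)"
      by (intro continuous_at_imp_continuous_on ballI has_derivative_continuous[OF d[OF that]])
  qed auto
  then show ?case using K unfolding Ckb.simps by blast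
next
  case (Suc k)
  have lin: "pd a \<psi> y = a *\<^sub>R pd 1 \<psi> y" for a y
    using pd_sum_Basis[OF Suc.prems(2), of a y] by simp
  have per: "pd 1 \<psi> (y + P) = pd 1 \<psi> y" for y
  proof -
    have "((\<lambda>y. y + P) has_derivative (\<lambda>v. v)) (at y)" by (auto intro!: derivative_eq_intros)
    from has_derivative_compose[OF this smooth_has_derivative[OF Suc.prems(2)]]
    have "(\<psi> has_derivative (\<lambda>v. pd v \<psi> (y + P))) (at y)" using Suc.prems(3) by simp
    from pd_eq[OF this] show ?thesis by simp
  qed
  note \<theta>' = Ckb_Suc[OF Suc.prems(1)]
  show ?case
  proof (rule Ckb_SucI)
    show "Ckb 0 S (\<lambda>s z. \<psi> (\<theta> s z))" using Ckb_0[OF Suc.IH[OF \<theta>' Suc.prems(2,3)]] .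
    show "((\<lambda>z. \<psi> (\<theta> s z)) has_derivative (\<lambda>v. \<theta>' s z v *\<^sub>R pd 1 \<psi> (\<theta> s z))) (at z)" if "s \<in> S" for s z
      using has_derivative_compose[OF d[OF that] smooth_has_derivative[OF Suc.prems(2)]] by (simp add: lin[symmetric])
    show "Ckb k S (\<lambda>s z. \<theta>' s z v *\<^sub>R pd 1 \<psi> (\<theta> s z))" for v
      using Ckb_scaleR[OF \<theta>' Suc.IH[OF \<theta>' smooth_pd[OF Suc.prems(2)] per]] .
  qed
qed

text \<open>The shape \<open>a * ... + b\<close> is stable under differentiation in the product
  variable: \<open>a\<close> collects the t-components of the directions, and \<open>b\<close>
  accommodates the constant derivative of the term -x in the phase.\<close>

lemma Ckb_funpow_dD:
  fixes q :: "'s \<Rightarrow> real \<Rightarrow> real"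
  assumes sm: "\<And>s. s \<in> S \<Longrightarrow> smooth (q s)"
    and "\<And>i. j \<le> i \<Longrightarrow> i \<le> j + k \<Longrightarrow> \<exists>K. \<forall>s\<in>S. \<forall>t. \<bar>(dD ^^ i) (q s) t\<bar> \<le> K"
  shows "Ckb k S (\<lambda>s (z::real \<times> real). a * (dD ^^ j) (q s) (fst z) + b)"
  using assms(2)
proof (induction k arbitrary: j a b)
  case 0
  obtain K where K: "\<forall>s\<in>S. \<forall>t. \<bar>(dD ^^ j) (q s) t\<bar> \<le> K" using 0[of j] by auto
  have "norm (a * (dD ^^ j) (q s) (fst z) + b) \<le> \<bar>a\<bar> * K + \<bar>b\<bar>" if "s \<in> S" for s and z :: "real \<times> real"
  proof -
    have "\<bar>a\<bar> * \<bar>(dD ^^ j) (q s) (fst z)\<bar> \<le> \<bar>a\<bar> * K" using K that by (intro mult_left_mono) auto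
    then show ?thesis using abs_triangle_ineq[of "a * (dD ^^ j) (q s) (fst z)" b] by (simp add: abs_mult)
  qed
  moreover have "continuous_on UNIV (\<lambda>z::real \<times> real. a * (dD ^^ j) (q s) (fst z) + b)" if "s \<in> S" for s
    by (intro continuous_intros continuous_on_compose2[OF smooth_continuous_on[OF smooth_funpow_dD[OF sm[OF that]]]]) auto
  ultimately show ?case unfolding Ckb.simps by blast
next
  case (Suc k)
  show ?case
  proof (rule Ckb_SucI)
    show "Ckb 0 S (\<lambda>s (z::real \<times> real). a * (dD ^^ j) (q s) (fst z) + b)"
      using Ckb_0[OF Suc.IH] Suc.prems by simp
    show "((\<lambda>z::real \<times> real. a * (dD ^^ j) (q s) (fst z) + b) has_derivative
        (\<lambda>v. (a * fst v) * (dD ^^ Suc j) (q s) (fst z) + 0)) (at z)" if "s \<in> S" for s z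
    proof -
      have sj: "smooth ((dD ^^ j) (q s))" by (rule smooth_funpow_dD[OF sm[OF that]])
      have "(fst has_derivative fst) (at z)" by (rule has_derivative_fst[OF has_derivative_ident, simplified])
      from has_derivative_compose[OF this smooth_has_derivative[OF sj]]
      have "((\<lambda>z. (dD ^^ j) (q s) (fst z)) has_derivative (\<lambda>v. pd (fst v) ((dD ^^ j) (q s)) (fst z))) (at z)" .
      moreover have "pd c ((dD ^^ j) (q s)) y = c * (dD ^^ Suc j) (q s) y" for c y
        using pd_sum_Basis[OF sj, of c y] by (simp add: dD_smooth[OF sj])
      ultimately have "((\<lambda>z. (dD ^^ j) (q s) (fst z)) has_derivative (\<lambda>v. fst v * (dD ^^ Suc j) (q s) (fst z))) (at z)"
        by simp
      then show ?thesis by (auto intro!: derivative_eq_intros simp: mult_ac)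
    qed
    show "Ckb k S (\<lambda>s (z::real \<times> real). (a * fst v) * (dD ^^ Suc j) (q s) (fst z) + 0)" for v :: "real \<times> real"
      by (rule Suc.IH) (use Suc.prems in auto)
  qed
qed

section \<open>Small divisors\<close>

abbreviation wt :: "int \<Rightarrow> int \<Rightarrow> real" where
  "wt m n \<equiv> 1 + \<bar>real_of_int m\<bar> + \<bar>real_of_int n\<bar>"

text \<open>With Q = 1 + n^2 and a Diophantine exponent below 3, the product of the two eigenvalues
  has modulus above c R^2 / Q^2, and Q is at most the square of the weight: this costs four powers.
  The other eigenvalue is at most (R + 1) times the weight, which costs the fifth power and the
  denominator in \<open>d\<close>.\<close>

lemma small_divisor_bound:
  assumes T: "T > 0" and irr: "irrationality_measure ((T / (2 * pi))\<^sup>2) = 2"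
  shows "\<exists>c>0. \<forall>m n. c \<le> \<bar>of_int m * (2 * pi / T) + sqrt (1 + (of_int n)\<^sup>2)\<bar> * wt m n ^ 5
    \<and> c \<le> \<bar>of_int m * (2 * pi / T) - sqrt (1 + (of_int n)\<^sup>2)\<bar> * wt m n ^ 5"
proof -
  \<comment> \<open>Apply the irrationality bound to p / q = m^2 / (1 + n^2).\<close>
  have "irrationality_measure ((T / (2 * pi))\<^sup>2) < 3" using irr by simp
  then obtain \<mu> c where \<mu>: "\<mu> < 3" and c: "c > 0" and dio: "\<And>p q::int. q > 0 \<Longrightarrow>
      c / (real_of_int q) powr \<mu> < \<bar>(T / (2 * pi))\<^sup>2 - real_of_int p / real_of_int q\<bar>"
    unfolding irrationality_measure_def Inf_less_iff by auto
  define R where "R = 2 * pi / T"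
  have R: "R > 0" using T by (simp add: R_def)
  define d where "d = c * R\<^sup>2 / (R + 1)"
  have d: "d > 0" using R c by (simp add: d_def)
  have "d \<le> \<bar>of_int m * R + sqrt (1 + (of_int n)\<^sup>2)\<bar> * wt m n ^ 5
    \<and> d \<le> \<bar>of_int m * R - sqrt (1 + (of_int n)\<^sup>2)\<bar> * wt m n ^ 5" for m n
  proof -
    define a where "a = of_int m * R"
    define w where "w = sqrt (1 + (of_int n)\<^sup>2)"
    define Q where "Q = 1 + (real_of_int n)\<^sup>2"
    define W where "W = wt m n"
    have W: "W \<ge> 1" by (simp add: W_def)
    have Q1: "Q \<ge> 1" by (simp add: Q_def)
    have w2: "w * w = Q" by (simp add: w_def Q_def)
    have w0: "w \<ge> 0" by (simp add: w_def)
    have wW: "w \<le> W"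
    proof -
      have "sqrt (1\<^sup>2 + (of_int n)\<^sup>2) \<le> \<bar>1\<bar> + \<bar>of_int n\<bar>" by (rule sqrt_sum_squares_le_sum_abs)
      then show ?thesis by (simp add: w_def W_def)
    qed
    have QW: "Q \<le> W * W" using mult_mono[OF wW wW] w2 w0 W by simp
    have aW: "\<bar>a\<bar> \<le> R * W"
      using R by (simp add: a_def W_def abs_mult mult.commute[of R] mult_right_mono)
    have "c / Q ^ 3 \<le> c / Q powr \<mu>"
    proof -
      have "Q powr \<mu> \<le> Q powr 3" using Q1 \<mu> by (intro powr_mono) auto
      then have "Q powr \<mu> \<le> Q ^ 3" using Q1 by simp
      then show ?thesis using c Q1 by (intro divide_left_mono mult_pos_pos) auto
    qed
    also have "\<dots> < \<bar>(T / (2 * pi))\<^sup>2 - (real_of_int m)\<^sup>2 / Q\<bar>"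
      using dio[of "1 + n\<^sup>2" "m\<^sup>2"] by (simp add: Q_def add_pos_nonneg)
    also have "(T / (2 * pi))\<^sup>2 - (real_of_int m)\<^sup>2 / Q = (Q - a * a) / (R\<^sup>2 * Q)"
      using Q1 T by (simp add: R_def a_def field_simps power2_eq_square)
    also have "\<bar>(Q - a * a) / (R\<^sup>2 * Q)\<bar> = \<bar>Q - a * a\<bar> / (R\<^sup>2 * Q)"
      using Q1 by (simp add: abs_divide)
    finally have "c / Q ^ 3 * (R\<^sup>2 * Q) < \<bar>Q - a * a\<bar>"
      using R Q1 by (simp add: pos_less_divide_eq)
    moreover have "c / Q ^ 3 * (R\<^sup>2 * Q) = c * R\<^sup>2 / Q\<^sup>2"
      using Q1 by (simp add: field_simps power2_eq_square power3_eq_cube)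
    moreover have "Q - a * a = - ((a + w) * (a - w))" using w2 by (simp add: algebra_simps)
    ultimately have "c * R\<^sup>2 / Q\<^sup>2 < \<bar>a + w\<bar> * \<bar>a - w\<bar>" by (simp add: abs_mult)
    then have "c * R\<^sup>2 < \<bar>a + w\<bar> * \<bar>a - w\<bar> * Q\<^sup>2" using Q1 by (simp add: pos_divide_less_eq)
    also have "\<dots> \<le> \<bar>a + w\<bar> * \<bar>a - w\<bar> * (W * W)\<^sup>2" using QW Q1 by (intro mult_left_mono power_mono) auto
    finally have main: "c * R\<^sup>2 \<le> \<bar>a + w\<bar> * \<bar>a - w\<bar> * W ^ 4"
      by (simp add: power2_eq_square power4_eq_xxxx mult_ac)
    have le: "\<bar>a + w\<bar> \<le> (R + 1) * W" "\<bar>a - w\<bar> \<le> (R + 1) * W"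
      using aW wW w0 by (auto simp: algebra_simps)
    have "c * R\<^sup>2 \<le> \<bar>a + w\<bar> * ((R + 1) * W) * W ^ 4"
      using main mult_right_mono[OF mult_left_mono[OF le(2), of "\<bar>a + w\<bar>"], of "W ^ 4"] W by simp
    moreover have "c * R\<^sup>2 \<le> ((R + 1) * W) * \<bar>a - w\<bar> * W ^ 4"
      using main mult_right_mono[OF mult_right_mono[OF le(1), of "\<bar>a - w\<bar>"], of "W ^ 4"] W by simp
    ultimately show ?thesis
      unfolding d_def a_def[symmetric] w_def[symmetric] W_def[symmetric]
      using R by (simp add: pos_divide_le_eq eval_nat_numeral mult_ac)
  qed
  then show ?thesis using d unfolding R_def by blast
qed

section \<open>From decay and convergence of coefficients to uniform convergence on the
  torus\<close>

lemma fcoef_pd: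
  assumes "T > 0" "smooth f" "torus_periodic T f"
  shows "fcoef T m n (pd v f) = \<i> * of_real (freq T m n v) * fcoef T m n f"
  using fcoef_derivative[OF assms(1) smooth_has_derivative[OF assms(2)] _ assms(3), of m n v]
    smooth_continuous_on[OF smooth_pd[OF assms(2)]] by simp

lemma abs_freq_le:
  assumes "T > 0"
  shows "\<bar>freq T m n v\<bar> \<le> (2 * pi / T + 1) * norm v * wt m n"
proof -
  have "\<bar>freq T m n v\<bar> \<le> \<bar>of_int m * (2 * pi / T) * fst v\<bar> + \<bar>of_int n * snd v\<bar>"
    unfolding freq_def by (rule abs_triangle_ineq)
  also have "\<bar>of_int m * (2 * pi / T) * fst v\<bar> \<le> wt m n * (2 * pi / T) * norm v"
    unfolding abs_mult using assms norm_fst_le[of "fst v" "snd v"] by (intro mult_mono) auto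
  also have "\<bar>of_int n * snd v\<bar> \<le> wt m n * norm v"
    unfolding abs_mult using norm_snd_le[of "snd v" "fst v"] by (intro mult_mono) auto
  finally show ?thesis by (simp add: algebra_simps add_divide_distrib)
qed

text \<open>\<open>Q\<close> is the product of the symbols of the directions in \<open>w\<close>. It
  is quantified before \<open>f\<close>, so the same multiplier serves for two different times and
  factors out of their difference.\<close>

lemma norm_fcoef_foldr_pd_le:
  assumes T: "T > 0"
  shows "\<exists>K\<ge>0. \<forall>m n. \<exists>Q. norm Q \<le> K * wt m n ^ length w \<and>
    (\<forall>f. smooth f \<longrightarrow> torus_periodic T f \<longrightarrow> fcoef T m n (foldr pd w f) = Q * fcoef T m n f)"
proof (induction w)
  case Nil
  show ?case by (intro exI[of _ 1] conjI allI) (auto intro!: exI[of _ "1 :: complex"])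
next
  case (Cons v w)
  obtain K where K: "K \<ge> 0" and KQ: "\<And>m n. \<exists>Q. norm Q \<le> K * wt m n ^ length w \<and>
    (\<forall>f. smooth f \<longrightarrow> torus_periodic T f \<longrightarrow> fcoef T m n (foldr pd w f) = Q * fcoef T m n f)"
    using Cons.IH by blast
  define L where "L = (2 * pi / T + 1) * norm v"
  have L: "L \<ge> 0" using T by (simp add: L_def)
  have "\<exists>Q. norm Q \<le> (L * K) * wt m n ^ length (v # w) \<and>
    (\<forall>f. smooth f \<longrightarrow> torus_periodic T f \<longrightarrow> fcoef T m n (foldr pd (v # w) f) = Q * fcoef T m n f)" for m n
  proof -
    obtain Q where Q: "norm Q \<le> K * wt m n ^ length w"
      "\<And>f. smooth f \<Longrightarrow> torus_periodic T f \<Longrightarrow> fcoef T m n (foldr pd w f) = Q * fcoef T m n f"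
      using KQ[of m n] by blast
    have "norm (\<i> * of_real (freq T m n v) * Q) = \<bar>freq T m n v\<bar> * norm Q" by (simp add: norm_mult)
    also have "\<dots> \<le> (L * wt m n) * (K * wt m n ^ length w)"
      using abs_freq_le[OF T, of m n v] Q(1) L by (intro mult_mono) (auto simp: L_def)
    finally have "norm (\<i> * of_real (freq T m n v) * Q) \<le> (L * K) * wt m n ^ length (v # w)"
      by (simp add: mult_ac)
    moreover have "fcoef T m n (foldr pd (v # w) f) = (\<i> * of_real (freq T m n v) * Q) * fcoef T m n f"
      if "smooth f" "torus_periodic T f" for f
      using fcoef_pd[OF T smooth_foldr_pd[OF that(1)] torus_periodic_foldr_pd[OF that], of m n v] Q(2)[OF that]
      by simp
    ultimately show ?thesis by blast
  qed
  then show ?case using K L by (intro exI[of _ "L * K"]) simp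
qed

lemma fcoef_integrable:
  "continuous_on UNIV f \<Longrightarrow> (\<lambda>z. f z * fmode T m n z) integrable_on cbox (0, 0) (T, 2 * pi)"
  by (intro integrable_continuous continuous_intros) (auto intro: continuous_on_subset)

lemma fcoef_diff:
  assumes "continuous_on UNIV f" "continuous_on UNIV g"
  shows "fcoef T m n (\<lambda>z. f z - g z) = fcoef T m n f - fcoef T m n g"
  unfolding fcoef_def left_diff_distrib using assms by (intro integral_diff fcoef_integrable)

text \<open>Finitely many low modes are close because each converges; the high modes are small
  uniformly in time because one power of decay is kept in reserve.\<close>

lemma torus_uniform_Cauchy:
  fixes A :: "real \<Rightarrow> real \<times> real \<Rightarrow> complex"
  assumes T: "T > 0" and sm: "\<And>s. smooth (A s)" and per: "\<And>s. torus_periodic T (A s)"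
    and lim: "\<And>m n. \<exists>L. ((\<lambda>s. fcoef T m n (A s)) \<longlongrightarrow> L) at_top"
    and dec: "\<And>N. \<exists>S K. \<forall>s\<ge>S. \<forall>m n. wt m n ^ N * norm (fcoef T m n (A s)) \<le> K"
    and e: "e > 0"
  shows "\<exists>S. \<forall>s\<ge>S. \<forall>s'\<ge>S. \<forall>z. norm (foldr pd w (A s) z - foldr pd w (A s') z) < e"
proof -
  obtain C where C: "C \<ge> 0" and CQ: "\<And>m n. \<exists>Q. norm Q \<le> C * wt m n ^ length w \<and>
    (\<forall>f. smooth f \<longrightarrow> torus_periodic T f \<longrightarrow> fcoef T m n (foldr pd w f) = Q * fcoef T m n f)"
    using norm_fcoef_foldr_pd_le[OF T] by blast
  \<comment> \<open>Four powers dominate the summation weight (1 + m^2)(1 + n^2), and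
    \<open>length w\<close> powers dominate the symbol of the derivative.\<close>
  define N where "N = 4 + length w"
  \<comment> \<open>Inserted into the sup bound with constant 25, this yields at most
    \<open>e / 2\<close>. The \<open>C + 1\<close> avoids division by zero.\<close>
  define d where "d = e * T * pi / (25 * (C + 1))"
  have d: "d > 0" using e T C by (simp add: d_def)
  obtain S0 K where K: "\<And>s m n. s \<ge> S0 \<Longrightarrow> wt m n ^ Suc N * norm (fcoef T m n (A s)) \<le> K"
    using dec[of "Suc N"] by blast
  obtain L where L: "\<And>m n. ((\<lambda>s. fcoef T m n (A s)) \<longlongrightarrow> L m n) at_top" using lim by metis
  \<comment> \<open>Outside the box of size \<open>M\<close> the weight is at least
    \<open>2 * K / d\<close>, so the reserve power compensates the bound \<open>2 * K\<close> on two
    coefficients.\<close>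
  define M where "M = \<lceil>2 * K / d\<rceil>"
  define d' where "d' m n = d / (2 * wt m n ^ N)" for m n
  have d': "d' m n > 0" for m n using d by (simp add: d'_def add_pos_nonneg)
  have "\<forall>\<^sub>F s in at_top. \<forall>p\<in>{-M..M} \<times> {-M..M}. dist (fcoef T (fst p) (snd p) (A s)) (L (fst p) (snd p)) < d' (fst p) (snd p)"
    by (intro eventually_ball_finite ballI tendstoD[OF L d']) auto
  then obtain S1 where S1: "\<And>s m n. s \<ge> S1 \<Longrightarrow> m \<in> {-M..M} \<Longrightarrow> n \<in> {-M..M} \<Longrightarrow>
      dist (fcoef T m n (A s)) (L m n) < d' m n"
    unfolding eventually_at_top_linorder by fastforce
  have small: "wt m n ^ N * norm (fcoef T m n (A s) - fcoef T m n (A s')) \<le> d"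
    if s: "s \<ge> max S0 S1" "s' \<ge> max S0 S1" for s s' m n
  proof (cases "m \<in> {-M..M} \<and> n \<in> {-M..M}")
    case True
    have "dist (fcoef T m n (A s)) (fcoef T m n (A s')) \<le> d' m n + d' m n"
      using dist_triangle2[of "fcoef T m n (A s)" "fcoef T m n (A s')" "L m n"]
        S1[of s m n] S1[of s' m n] True s by fastforce
    then have "wt m n ^ N * norm (fcoef T m n (A s) - fcoef T m n (A s')) \<le> wt m n ^ N * (d' m n + d' m n)"
      by (intro mult_left_mono) (auto simp: dist_norm)
    also have "\<dots> = d"
    proof -
      have "wt m n ^ N \<noteq> 0" by (simp add: add_nonneg_eq_0_iff)
      then show ?thesis unfolding d'_def by simp
    qed
    finally show ?thesis .
  next
    case False
    then have "real_of_int M \<le> wt m n" by (auto; linarith)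
    then have W: "2 * K / d \<le> wt m n" unfolding M_def by linarith
    have "wt m n ^ Suc N * norm (fcoef T m n (A s) - fcoef T m n (A s'))
      \<le> wt m n ^ Suc N * (norm (fcoef T m n (A s)) + norm (fcoef T m n (A s')))"
      by (intro mult_left_mono norm_triangle_ineq4) simp
    also have "\<dots> \<le> 2 * K" unfolding distrib_left using K[of s m n] K[of s' m n] s by linarith
    also have "\<dots> \<le> d * wt m n" using W d by (simp add: pos_divide_le_eq mult.commute)
    finally have "wt m n * (wt m n ^ N * norm (fcoef T m n (A s) - fcoef T m n (A s'))) \<le> wt m n * d"
      by (simp add: mult_ac)
    moreover have "wt m n > 0" by (simp add: add_pos_nonneg)
    ultimately show ?thesis by (simp only: mult_le_cancel_left_pos)
  qed
  have "norm (foldr pd w (A s) z - foldr pd w (A s') z) < e" if s: "s \<ge> max S0 S1" "s' \<ge> max S0 S1" for s s' z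
  proof -
    define f where "f z = foldr pd w (A s) z - foldr pd w (A s') z" for z
    note sw = smooth_foldr_pd[OF sm]
    have fs: "smooth f" unfolding f_def[abs_def] by (intro smooth_diff sw)
    have fp: "torus_periodic T f"
      using torus_periodic_foldr_pd[OF sm per] by (simp add: f_def torus_periodic_def)
    have "2 * pi * T * norm (f z) \<le> 25 * (C * d)"
    proof (rule fourier_sup_bound_2d[OF T smooth_has_derivative[OF fs] _ fp])
      show "continuous_on UNIV (\<lambda>z. pd v f z)" for v
        using smooth_continuous_on[OF smooth_pd[OF fs]] .
      fix m n
      obtain Q where Q: "norm Q \<le> C * wt m n ^ length w"
        "\<And>s. fcoef T m n (foldr pd w (A s)) = Q * fcoef T m n (A s)"
        using CQ[of m n] sm per by blast
      have fc: "fcoef T m n f = Q * (fcoef T m n (A s) - fcoef T m n (A s'))"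
        unfolding f_def[abs_def] fcoef_diff[OF smooth_continuous_on[OF sw] smooth_continuous_on[OF sw]] Q(2)
        by (simp add: algebra_simps)
      have sq: "1 + (real_of_int k)\<^sup>2 \<le> wt m n ^ 2" if "k = m \<or> k = n" for k
      proof -
        have "1 + (real_of_int k)\<^sup>2 \<le> (1 + \<bar>real_of_int k\<bar>)\<^sup>2" by (simp add: power2_eq_square algebra_simps)
        also have "\<dots> \<le> wt m n ^ 2" using that by (intro power_mono) auto
        finally show ?thesis .
      qed
      have "(1 + (real_of_int m)\<^sup>2) * (1 + (real_of_int n)\<^sup>2) \<le> wt m n ^ 2 * wt m n ^ 2"
        using sq by (intro mult_mono) auto
      then have w4: "(1 + (real_of_int m)\<^sup>2) * (1 + (real_of_int n)\<^sup>2) \<le> wt m n ^ 4"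
        by (simp add: power_add[symmetric])
      have "(1 + (real_of_int m)\<^sup>2) * (1 + (real_of_int n)\<^sup>2) * norm (fcoef T m n f)
         \<le> wt m n ^ 4 * (C * wt m n ^ length w * norm (fcoef T m n (A s) - fcoef T m n (A s')))"
        unfolding fc norm_mult using Q(1) C by (intro mult_mono w4) (auto intro!: mult_right_mono)
      also have "\<dots> = C * (wt m n ^ N * norm (fcoef T m n (A s) - fcoef T m n (A s')))"
        by (simp add: N_def power_add mult_ac)
      also have "\<dots> \<le> C * d" using small[OF s] C by (intro mult_left_mono)
      finally show "(1 + (real_of_int m)\<^sup>2) * (1 + (real_of_int n)\<^sup>2) * norm (fcoef T m n f) \<le> C * d" .
    qed
    also have "\<dots> \<le> 25 * ((C + 1) * d)" using d by simp
    also have "\<dots> = e * T * pi" using C by (simp add: d_def field_simps)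
    finally have "pi * T * (2 * norm (f z)) \<le> pi * T * e" by (simp add: mult_ac)
    then have "2 * norm (f z) \<le> e" using T by simp
    then show ?thesis using e norm_ge_zero[of "f z"] unfolding f_def by linarith
  qed
  then show ?thesis by blast
qed

section \<open>The coupled system of Fourier modes\<close>

lemma fcoef_add:
  assumes "continuous_on UNIV f" "continuous_on UNIV g"
  shows "fcoef T m n (\<lambda>z. f z + g z) = fcoef T m n f + fcoef T m n g"
  unfolding fcoef_def distrib_right using assms by (intro integral_add fcoef_integrable)

lemma fcoef_cmult: "fcoef T m n (\<lambda>z. c * f z) = c * fcoef T m n f"
  unfolding fcoef_def mult.assoc by (rule integral_mult_right)

lemma fcoef_has_vector_derivative:
  assumes c: "\<And>s. continuous_on UNIV (A s)"
    and d: "\<And>s z. ((\<lambda>s. A s z) has_vector_derivative A' s z) (at s)"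
    and c': "continuous_on UNIV (\<lambda>(s, z). A' s z)"
  shows "((\<lambda>s. fcoef T m n (A s)) has_vector_derivative fcoef T m n (A' s)) (at s)"
  unfolding fcoef_def
proof (rule leibniz_rule_vector_derivative[where U=UNIV])
  show "((\<lambda>s. A s z * fmode T m n z) has_vector_derivative A' s z * fmode T m n z) (at s)" for s z
    by (intro has_vector_derivative_mult_left d)
  show "(\<lambda>z. A s z * fmode T m n z) integrable_on cbox (0, 0) (T, 2 * pi)" for s
    by (rule fcoef_integrable[OF c])
  show "continuous_on (UNIV \<times> cbox (0, 0) (T, 2 * pi)) (\<lambda>(s, z). A' s z * fmode T m n z)"
    using continuous_on_subset[OF c', of "UNIV \<times> cbox (0, 0) (T, 2 * pi)"] unfolding case_prod_unfold
    by (intro continuous_on_mult continuous_on_compose2[OF continuous_on_fmode[of UNIV]] continuous_intros) auto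
qed auto

lemma fcoef_tendsto:
  assumes T: "T > 0" and c: "\<And>s. continuous_on UNIV (F s)" "continuous_on UNIV F1"
    and u: "uniform_limit UNIV F F1 at_top"
  shows "((\<lambda>s. fcoef T m n (F s)) \<longlongrightarrow> fcoef T m n F1) at_top"
proof (rule tendstoI)
  fix e :: real assume e: "e > 0"
  define d where "d = e / (4 * pi * T)"
  have d: "d > 0" using e T by (simp add: d_def)
  from uniform_limitD[OF u d] show "\<forall>\<^sub>F s in at_top. dist (fcoef T m n (F s)) (fcoef T m n F1) < e"
  proof eventually_elim
    case (elim s)
    have "norm (fcoef T m n (\<lambda>z. F s z - F1 z)) \<le> d * (2 * pi * T)"
      using elim by (intro norm_fcoef_le[OF T] continuous_intros c) (auto simp: dist_norm less_imp_le)
    also have "\<dots> < e" using e T by (simp add: d_def)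
    finally show ?case by (simp add: dist_norm fcoef_diff[OF c])
  qed
qed

text \<open>The analytic core: for the reduced complex system, each coefficient converges and the
  decay is uniform over late times. The hypothesis \<open>en\<close> is the form in which finite
  energy enters; \<open>Fb\<close> lets the starting time depend on the order of decay
  wanted.\<close>

lemma fcoef_coupled_system:
  fixes A A' C C' F :: "real \<Rightarrow> real \<times> real \<Rightarrow> complex"
  assumes T: "T > 0" and irr: "irrationality_measure ((T / (2 * pi))\<^sup>2) = 2"
    and smA: "\<And>s. smooth (A s)" and perA: "\<And>s. torus_periodic T (A s)"
    and smC: "\<And>s. smooth (C s)" and perC: "\<And>s. torus_periodic T (C s)"
    and dA: "\<And>s z. ((\<lambda>s. A s z) has_vector_derivative A' s z) (at s)"
    and dC: "\<And>s z. ((\<lambda>s. C s z) has_vector_derivative C' s z) (at s)"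
    and cA': "continuous_on UNIV (\<lambda>(s, z). A' s z)"
    and cC': "continuous_on UNIV (\<lambda>(s, z). C' s z)"
    and eqA: "\<And>s z. A' s z = - \<i> * pd (1, 0) (A s) z + \<i> * pd (0, 1) (C s) z + A s z + F s z"
    and eqC: "\<And>s z. C' s z = - \<i> * pd (1, 0) (C s) z + \<i> * pd (0, 1) (A s) z - C s z"
    and cF: "\<And>s. continuous_on UNIV (F s)" and perF: "\<And>s. torus_periodic T (F s)"
    and Fb: "\<And>k. \<exists>S::real. Ckb k {S..} F"
    and Fl: "uniform_limit UNIV F F1 at_top" and cF1: "continuous_on UNIV F1"
    and en: "\<And>S. \<exists>s\<ge>S. integral (cbox (0, 0) (T, 2 * pi)) (\<lambda>z. (norm (A' s z))\<^sup>2 + (norm (C' s z))\<^sup>2) \<le> 1"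
  shows "\<exists>L. ((\<lambda>s. fcoef T m n (A s)) \<longlongrightarrow> L) at_top"
    and "\<exists>L. ((\<lambda>s. fcoef T m n (C s)) \<longlongrightarrow> L) at_top"
    and "\<exists>S K. \<forall>s\<ge>S. \<forall>m n. wt m n ^ N * norm (fcoef T m n (A s)) \<le> K"
    and "\<exists>S K. \<forall>s\<ge>S. \<forall>m n. wt m n ^ N * norm (fcoef T m n (C s)) \<le> K"
proof -
  define w where "w n = sqrt (1 + (real_of_int n)\<^sup>2)" for n :: int
  define a where "a m = of_int m * (2 * pi / T)" for m :: int
  define f where "f m n s = fcoef T m n (F s)" for m n s
  define ca where "ca m n s = fcoef T m n (A s)" for m n s
  define cc where "cc m n s = fcoef T m n (C s)" for m n s
  \<comment> \<open>The mode (m, n) obeys (ca, cc)' = (a + B) (ca, cc) + (f, 0) with B = ((1, -n), (-n, -1)) symmetric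
    and eigenvalues w, -w; y1 and y2 are the coordinates along left eigenvectors of B.\<close>
  define y1 where "y1 m n s = of_real (w n + 1) * ca m n s - of_int n * cc m n s" for m n s
  define y2 where "y2 m n s = of_int n * ca m n s + of_real (w n + 1) * cc m n s" for m n s
  have w2: "w n * w n = 1 + real_of_int n * real_of_int n" for n
    by (simp add: w_def power2_eq_square)
  then have w2c: "complex_of_real (w n) * complex_of_real (w n) = 1 + of_int n * of_int n" for n
    by (metis of_real_1 of_real_add of_real_mult of_real_of_int_eq)
  have w0: "w n \<ge> 1" for n by (simp add: w_def)
  have wW: "w n \<le> wt m n" for m n
  proof -
    have "sqrt (1\<^sup>2 + (of_int n)\<^sup>2) \<le> \<bar>1\<bar> + \<bar>of_int n\<bar>" by (rule sqrt_sum_squares_le_sum_abs)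
    then show ?thesis by (simp add: w_def)
  qed
  have cA: "continuous_on UNIV (A s)" and cC: "continuous_on UNIV (C s)" for s
    using smooth_continuous_on smA smC by blast+
  have cpA: "continuous_on UNIV (pd v (A s))" and cpC: "continuous_on UNIV (pd v (C s))" for s v
    using smooth_continuous_on smooth_pd smA smC by blast+
  have A'eq: "fcoef T m n (A' s) = of_real (a m) * ca m n s - of_int n * cc m n s + ca m n s + f m n s" for m n s
  proof -
    have "A' s = (\<lambda>z. - \<i> * pd (1, 0) (A s) z + \<i> * pd (0, 1) (C s) z + A s z + F s z)" by (rule ext) (rule eqA)
    then have "fcoef T m n (A' s) = - \<i> * fcoef T m n (pd (1, 0) (A s)) + \<i> * fcoef T m n (pd (0, 1) (C s)) + ca m n s + f m n s"
      by (simp only: fcoef_add fcoef_cmult continuous_on_add continuous_on_mult continuous_on_const cpA cpC cA cC cF ca_def f_def)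
    then show ?thesis
      by (simp add: fcoef_pd[OF T smA perA] fcoef_pd[OF T smC perC] freq_def a_def ca_def cc_def f_def mult.assoc[symmetric])
  qed
  have C'eq: "fcoef T m n (C' s) = of_real (a m) * cc m n s - of_int n * ca m n s - cc m n s" for m n s
  proof -
    have "C' s = (\<lambda>z. - \<i> * pd (1, 0) (C s) z + \<i> * pd (0, 1) (A s) z - C s z)" by (rule ext) (rule eqC)
    then have "fcoef T m n (C' s) = - \<i> * fcoef T m n (pd (1, 0) (C s)) + \<i> * fcoef T m n (pd (0, 1) (A s)) - cc m n s"
      by (simp only: fcoef_add fcoef_diff fcoef_cmult continuous_on_add continuous_on_mult continuous_on_const cpA cpC cA cC cc_def)
    then show ?thesis
      by (simp add: fcoef_pd[OF T smA perA] fcoef_pd[OF T smC perC] freq_def a_def ca_def cc_def mult.assoc[symmetric])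
  qed
  have cad: "(ca m n has_vector_derivative fcoef T m n (A' s)) (at s)" for m n s
    unfolding ca_def[abs_def] by (rule fcoef_has_vector_derivative[OF cA dA cA'])
  have ccd: "(cc m n has_vector_derivative fcoef T m n (C' s)) (at s)" for m n s
    unfolding cc_def[abs_def] by (rule fcoef_has_vector_derivative[OF cC dC cC'])
  \<comment> \<open>The left eigenvector identities, which hold because w^2 = 1 + n^2.\<close>
  have y1': "of_real (w n + 1) * fcoef T m n (A' s) - of_int n * fcoef T m n (C' s)
      = of_real (a m + w n) * y1 m n s + of_real (w n + 1) * f m n s" for m n s
    unfolding A'eq C'eq y1_def using w2c[of n] by (simp add: algebra_simps) algebra
  have y2': "of_int n * fcoef T m n (A' s) + of_real (w n + 1) * fcoef T m n (C' s)
      = of_real (a m - w n) * y2 m n s + of_int n * f m n s" for m n s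
    unfolding A'eq C'eq y2_def using w2c[of n] by (simp add: algebra_simps) algebra
  have y1d: "(y1 m n has_vector_derivative of_real (a m + w n) * y1 m n s + of_real (w n + 1) * f m n s) (at s)" for m n s
    unfolding y1'[symmetric] unfolding y1_def[abs_def]
    by (intro has_vector_derivative_diff has_vector_derivative_mult_right cad ccd)
  have y2d: "(y2 m n has_vector_derivative of_real (a m - w n) * y2 m n s + of_int n * f m n s) (at s)" for m n s
    unfolding y2'[symmetric] unfolding y2_def[abs_def]
    by (intro has_vector_derivative_add has_vector_derivative_mult_right cad ccd)
  have slice: "continuous_on S (B s)" if "continuous_on UNIV (\<lambda>(s, z). B s z)"
    for B :: "real \<Rightarrow> real \<times> real \<Rightarrow> complex" and s S
  proof -
    have "continuous_on S (\<lambda>z. (\<lambda>(s, z). B s z) (s, z))"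
      by (rule continuous_on_compose2[OF that]) (auto intro!: continuous_intros)
    then show ?thesis by simp
  qed
  note A's = slice[OF cA'] and C's = slice[OF cC']
  \<comment> \<open>The elementary inequality x \<le> 1 + x^2 + y^2 replaces Cauchy-Schwarz: the L2
    bound 1 becomes an L1 bound by the area of the torus plus 1.\<close>
  have recur: "\<exists>s\<ge>S. norm (fcoef T m n (A' s)) \<le> 2 * pi * T + 1 \<and> norm (fcoef T m n (C' s)) \<le> 2 * pi * T + 1" for S m n
  proof -
    obtain s where s: "s \<ge> S"
      "integral (cbox (0, 0) (T, 2 * pi)) (\<lambda>z. (norm (A' s z))\<^sup>2 + (norm (C' s z))\<^sup>2) \<le> 1" using en by blast
    have "integral (cbox (0, 0) (T, 2 * pi)) (\<lambda>z. 1 + ((norm (A' s z))\<^sup>2 + (norm (C' s z))\<^sup>2))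
       = 2 * pi * T + integral (cbox (0, 0) (T, 2 * pi)) (\<lambda>z. (norm (A' s z))\<^sup>2 + (norm (C' s z))\<^sup>2)"
      using T by (subst integral_add)
        (auto intro!: integrable_continuous continuous_intros A's C's simp: content_Pair)
    then have le: "integral (cbox (0, 0) (T, 2 * pi)) (\<lambda>z. 1 + ((norm (A' s z))\<^sup>2 + (norm (C' s z))\<^sup>2)) \<le> 2 * pi * T + 1"
      using s by simp
    have sq: "x \<le> 1 + (x\<^sup>2 + y\<^sup>2)" "x \<le> 1 + (y\<^sup>2 + x\<^sup>2)" for x y :: real
    proof -
      have "0 \<le> (x - 1)\<^sup>2 + x\<^sup>2 + 1 + 2 * y\<^sup>2" by simp
      then show "x \<le> 1 + (x\<^sup>2 + y\<^sup>2)" "x \<le> 1 + (y\<^sup>2 + x\<^sup>2)" by (simp_all add: power2_eq_square algebra_simps)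
    qed
    have "norm (fcoef T m n (A' s)) \<le> integral (cbox (0, 0) (T, 2 * pi)) (\<lambda>z. 1 + ((norm (A' s z))\<^sup>2 + (norm (C' s z))\<^sup>2))"
      unfolding fcoef_def by (intro integral_norm_bound_integral fcoef_integrable A's integrable_continuous continuous_intros C's)
        (simp add: norm_mult sq)
    moreover have "norm (fcoef T m n (C' s)) \<le> integral (cbox (0, 0) (T, 2 * pi)) (\<lambda>z. 1 + ((norm (A' s z))\<^sup>2 + (norm (C' s z))\<^sup>2))"
      unfolding fcoef_def by (intro integral_norm_bound_integral fcoef_integrable A's integrable_continuous continuous_intros C's)
        (simp add: norm_mult sq)
    ultimately show ?thesis using le s(1) by (intro exI[of _ s]) linarith
  qed
  have recur12: "\<exists>s\<ge>S. norm (p * fcoef T m n (A' s) + q * fcoef T m n (C' s)) < (norm p + norm q) * (2 * pi * T + 1) + 1" for p q S m n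
  proof -
    obtain s where s: "s \<ge> S" "norm (fcoef T m n (A' s)) \<le> 2 * pi * T + 1" "norm (fcoef T m n (C' s)) \<le> 2 * pi * T + 1"
      using recur by blast
    have "norm (p * fcoef T m n (A' s) + q * fcoef T m n (C' s)) \<le> norm p * norm (fcoef T m n (A' s)) + norm q * norm (fcoef T m n (C' s))"
      by (metis norm_mult norm_triangle_ineq)
    also have "\<dots> \<le> norm p * (2 * pi * T + 1) + norm q * (2 * pi * T + 1)"
      using s by (intro add_mono mult_left_mono) auto
    finally show ?thesis using s(1) by (intro exI[of _ s]) (simp add: distrib_right)
  qed
  have recur1: "\<exists>s\<ge>S. norm (of_real (a m + w n) * y1 m n s + of_real (w n + 1) * f m n s)
      < (norm (complex_of_real (w n + 1)) + norm (- complex_of_int n)) * (2 * pi * T + 1) + 1" for S m n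
    using recur12[of S "of_real (w n + 1)" m n "- of_int n"] unfolding y1'[symmetric] by simp
  have recur2: "\<exists>s\<ge>S. norm (of_real (a m - w n) * y2 m n s + of_int n * f m n s)
      < (norm (complex_of_int n) + norm (complex_of_real (w n + 1))) * (2 * pi * T + 1) + 1" for S m n
    using recur12[of S "of_int n" m n "of_real (w n + 1)"] unfolding y2'[symmetric] by simp
  obtain c where c: "c > 0" and div: "\<And>m n. c \<le> \<bar>a m + w n\<bar> * wt m n ^ 5" "\<And>m n. c \<le> \<bar>a m - w n\<bar> * wt m n ^ 5"
    using small_divisor_bound[OF T irr] unfolding a_def w_def by blast
  have l0: "a m + w n \<noteq> 0" "a m - w n \<noteq> 0" for m n using div[of m n] c by auto
  \<comment> \<open>The eigenvectors (w + 1, -n) and (n, w + 1) are orthogonal with common squared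
    length \<open>D n\<close>, so the change of coordinates is inverted by its transpose divided by
    \<open>D n\<close>. The entry w + 1 keeps them nonzero at n = 0.\<close>
  define D where "D n = (w n + 1) * (w n + 1) + of_int n * of_int n" for n
  have D: "D n > 0" for n using w0[of n] by (simp add: D_def add_pos_nonneg)
  have caD: "of_real (D n) * ca m n s = of_real (w n + 1) * y1 m n s + of_int n * y2 m n s" for m n s
    by (simp add: D_def y1_def y2_def algebra_simps)
  have ccD: "of_real (D n) * cc m n s = of_real (w n + 1) * y2 m n s - of_int n * y1 m n s" for m n s
    by (simp add: D_def y1_def y2_def algebra_simps)
  have ca: "ca m n s = (of_real (w n + 1) * y1 m n s + of_int n * y2 m n s) / of_real (D n)" for m n s
    using caD[of n m s] D[of n] by (simp add: field_simps)
  have cc: "cc m n s = (of_real (w n + 1) * y2 m n s - of_int n * y1 m n s) / of_real (D n)" for m n s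
    using ccD[of n m s] D[of n] by (simp add: field_simps)
  have flim: "(f m n \<longlongrightarrow> fcoef T m n F1) at_top" for m n
    unfolding f_def[abs_def] by (rule fcoef_tendsto[OF T cF cF1 Fl])
  have y1lim: "\<exists>L. (y1 m n \<longlongrightarrow> L) at_top" and y2lim: "\<exists>L. (y2 m n \<longlongrightarrow> L) at_top" for m n
    using linear_ode_tendsto[OF l0(1) y1d tendsto_mult[OF tendsto_const flim] recur1]
      linear_ode_tendsto[OF l0(2) y2d tendsto_mult[OF tendsto_const flim] recur2] by blast+
  obtain L1 L2 where L: "(y1 m n \<longlongrightarrow> L1) at_top" "(y2 m n \<longlongrightarrow> L2) at_top"
    using y1lim y2lim by blast
  have D0: "complex_of_real (D n) \<noteq> 0" using D[of n] by simp
  note mult_L = tendsto_mult[OF tendsto_const L(1)] tendsto_mult[OF tendsto_const L(2)]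
  show "\<exists>L. ((\<lambda>s. fcoef T m n (A s)) \<longlongrightarrow> L) at_top"
    unfolding ca_def[symmetric] ca
    by (rule exI, rule tendsto_divide[OF tendsto_add[OF mult_L] tendsto_const D0])
  show "\<exists>L. ((\<lambda>s. fcoef T m n (C s)) \<longlongrightarrow> L) at_top"
    unfolding cc_def[symmetric] cc
    by (rule exI, rule tendsto_divide[OF tendsto_diff[OF mult_L(2,1)] tendsto_const D0])
  \<comment> \<open>\<open>D n\<close> dominates both w + 1 and |n|, so returning from the
    eigencomponents to the coefficients costs no power of the weight.\<close>
  have key: "norm y \<le> norm x1 + norm x2" if "of_real (D n) * y = of_real (w n + 1) * x1 + of_int n * x2
      \<or> of_real (D n) * y = of_real (w n + 1) * x1 - of_int n * x2" for y x1 x2 :: complex and n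
  proof -
    have "\<bar>real_of_int n\<bar> \<le> D n"
    proof -
      have "0 \<le> (\<bar>real_of_int n\<bar> - 1)\<^sup>2" by simp
      then have "2 * \<bar>real_of_int n\<bar> \<le> 1 + real_of_int n * real_of_int n" by (simp add: power2_eq_square algebra_simps)
      moreover have "1 \<le> (w n + 1) * (w n + 1)" using w0[of n] by (simp add: mult_ge1_I)
      ultimately show ?thesis unfolding D_def by linarith
    qed
    moreover have "w n + 1 \<le> D n"
    proof -
      have "(w n + 1) * 1 \<le> (w n + 1) * (w n + 1)" using w0[of n] by (intro mult_left_mono) auto
      then show ?thesis by (simp add: D_def add_increasing2)
    qed
    moreover have "D n * norm y \<le> (w n + 1) * norm x1 + \<bar>real_of_int n\<bar> * norm x2"
    proof -
      have "D n * norm y = norm (of_real (D n) * y)" using D[of n] by (simp add: norm_mult)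
      also have "\<dots> \<le> norm (of_real (w n + 1) * x1) + norm (of_int n * x2)"
        using that norm_triangle_ineq norm_triangle_ineq4 by metis
      finally show ?thesis using w0[of n] by (simp add: norm_mult)
    qed
    ultimately have "D n * norm y \<le> D n * norm x1 + D n * norm x2"
      by (meson add_mono mult_right_mono norm_ge_zero order_trans)
    then have "D n * norm y \<le> D n * (norm x1 + norm x2)" by (simp add: distrib_left)
    then show ?thesis using D[of n] by simp
  qed
  \<comment> \<open>Of the six extra orders, five pay for the small divisor and one for the factor w
    + 1 or \<open>n\<close> in front of the forcing. The initial data at \<open>S\<close> need one
    extra power, for the same factor.\<close>
  obtain S where S: "Ckb (N + 6) {S..} F" using Fb by blast
  obtain KF where KF: "\<And>s m n. s \<ge> S \<Longrightarrow> wt m n ^ (N + 6) * norm (f m n s) \<le> KF"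
    using fcoef_decay[OF T S perF] unfolding f_def by auto
  obtain KA where KA: "\<And>m n. wt m n ^ (N + 1) * norm (ca m n S) \<le> KA"
    using fcoef_decay[OF T Ckb_smooth_torus_periodic[OF T smA perA], of "{S}" S "N + 1"] perA unfolding ca_def by auto
  obtain KC where KC: "\<And>m n. wt m n ^ (N + 1) * norm (cc m n S) \<le> KC"
    using fcoef_decay[OF T Ckb_smooth_torus_periodic[OF T smC perC], of "{S}" S "N + 1"] perC unfolding cc_def by auto
  define K where "K = 2 * KA + 2 * KC + 2 * KF / c"
  \<comment> \<open>Both eigencomponents are treated at once: \<open>p\<close> is the factor of the
    forcing and \<open>l\<close> the eigenvalue. The bound \<open>K\<close> is independent of the
    mode, whereas \<open>K'\<close> may vary with it.\<close>
  have yb: "wt m n ^ N * norm (y s) \<le> K"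
    if s: "s \<ge> S" and l: "c \<le> \<bar>l\<bar> * wt m n ^ 5" "l \<noteq> 0"
      and d: "\<And>s. (y has_vector_derivative (of_real l * y s + p * f m n s)) (at s)"
      and r: "\<And>S. \<exists>s\<ge>S. norm (of_real l * y s + p * f m n s) < K'"
      and p: "norm p \<le> 2 * wt m n"
      and y0: "norm (y S) \<le> 2 * wt m n * norm (ca m n S) + 2 * wt m n * norm (cc m n S)"
    for m n s y l p K'
  proof -
    let ?W = "wt m n"
    have W: "?W > 0" by (simp add: add_pos_nonneg)
    have fb: "norm (f m n s) \<le> KF / ?W ^ (N + 6)" if "s \<ge> S" for s
      using KF[OF that, of m n] W by (simp add: pos_le_divide_eq mult.commute)
    have g: "norm (p * f m n s) \<le> 2 * ?W * (KF / ?W ^ (N + 6))" if "s \<ge> S" for s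
      unfolding norm_mult using fb[OF that] p W by (intro mult_mono) auto
    have KF0: "KF \<ge> 0" using KF[of S m n] W by (meson mult_nonneg_nonneg norm_ge_zero order_refl order_trans zero_le_power less_imp_le)
    have "norm (y s) \<le> norm (y S) + 2 * ?W * (KF / ?W ^ (N + 6)) / \<bar>l\<bar>"
      by (rule linear_ode_bound[OF l(2) d g r s])
    then have "?W ^ N * norm (y s) \<le> ?W ^ N * (norm (y S) + 2 * ?W * (KF / ?W ^ (N + 6)) / \<bar>l\<bar>)"
      using W by (intro mult_left_mono) auto
    also have "\<dots> = ?W ^ N * norm (y S) + ?W ^ N * (2 * ?W * (KF / ?W ^ (N + 6)) / \<bar>l\<bar>)"
      by (rule distrib_left)
    also have "?W ^ N * norm (y S) \<le> 2 * KA + 2 * KC"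
    proof -
      have "?W ^ N * norm (y S) \<le> ?W ^ N * (2 * ?W * norm (ca m n S) + 2 * ?W * norm (cc m n S))"
        using y0 W by (intro mult_left_mono) auto
      also have "\<dots> = 2 * (?W ^ (N + 1) * norm (ca m n S)) + 2 * (?W ^ (N + 1) * norm (cc m n S))"
        by (simp add: algebra_simps)
      finally show ?thesis using KA[of m n] KC[of m n] by linarith
    qed
    also have "?W ^ N * (2 * ?W * (KF / ?W ^ (N + 6)) / \<bar>l\<bar>) = 2 * KF / (\<bar>l\<bar> * ?W ^ 5)"
    proof -
      have W6: "?W ^ (N + 6) = ?W ^ N * ?W * ?W ^ 5" by (simp add: power_add eval_nat_numeral)
      have "x * (2 * v * (KF / (x * v * z)) / \<bar>l\<bar>) = 2 * KF / (\<bar>l\<bar> * z)" if "x \<noteq> 0" "v \<noteq> 0" for x v z :: real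
        using that by (simp add: field_simps)
      from this[of "?W ^ N" ?W "?W ^ 5"] show ?thesis unfolding W6 using W by simp
    qed
    also have "2 * KF / (\<bar>l\<bar> * ?W ^ 5) \<le> 2 * KF / c"
      using l c KF0 by (intro divide_left_mono) (auto intro: mult_pos_pos less_le_trans)
    finally show ?thesis by (simp add: K_def)
  qed
  have pW: "norm (complex_of_real (w n + 1)) \<le> 2 * wt m n" and nW: "norm (complex_of_int n) \<le> 2 * wt m n" for m n
    using wW[of n m] w0[of n] by auto
  have yb1: "wt m n ^ N * norm (y1 m n s) \<le> K" if "s \<ge> S" for m n s
  proof (rule yb[OF that div(1) l0(1) y1d recur1 pW])
    show "norm (y1 m n S) \<le> 2 * wt m n * norm (ca m n S) + 2 * wt m n * norm (cc m n S)"
      unfolding y1_def by (rule order_trans[OF norm_triangle_ineq4], unfold norm_mult,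
          intro add_mono mult_right_mono pW nW norm_ge_zero)
  qed
  have yb2: "wt m n ^ N * norm (y2 m n s) \<le> K" if "s \<ge> S" for m n s
  proof (rule yb[OF that div(2) l0(2) y2d recur2 nW])
    show "norm (y2 m n S) \<le> 2 * wt m n * norm (ca m n S) + 2 * wt m n * norm (cc m n S)"
      unfolding y2_def by (rule order_trans[OF norm_triangle_ineq], unfold norm_mult,
          intro add_mono mult_right_mono pW nW norm_ge_zero)
  qed
  have fin: "wt m n ^ N * norm y \<le> 2 * K" if "norm y \<le> norm (y1 m n s) + norm (y2 m n s)" "s \<ge> S" for m n y s
  proof -
    have "wt m n ^ N * norm y \<le> wt m n ^ N * (norm (y1 m n s) + norm (y2 m n s))"
      using that by (intro mult_left_mono) auto
    then show ?thesis using yb1[OF that(2), of m n] yb2[OF that(2), of m n] unfolding distrib_left by linarith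
  qed
  have "norm (ca m n s) \<le> norm (y1 m n s) + norm (y2 m n s)" for m n s
    using key caD by blast
  then show "\<exists>S K. \<forall>s\<ge>S. \<forall>m n. wt m n ^ N * norm (fcoef T m n (A s)) \<le> K"
    unfolding ca_def[symmetric] using fin by blast
  have "norm (cc m n s) \<le> norm (y1 m n s) + norm (y2 m n s)" for m n s
    using key[of n "cc m n s" "y2 m n s" "y1 m n s"] ccD[of n m s] by simp
  then show "\<exists>S K. \<forall>s\<ge>S. \<forall>m n. wt m n ^ N * norm (fcoef T m n (C s)) \<le> K"
    unfolding cc_def[symmetric] using fin by blast
qed

section \<open>Convergence\<close>

lemma grad_Sfun:
  "grad (Sfun \<rho> t x u) Z $ 1 = Z $ 1 + rho_S1 \<rho> (u $ 1 - x)"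
  "grad (Sfun \<rho> t x u) Z $ 2 = Z $ 2"
  "grad (Sfun \<rho> t x u) Z $ 3 = - Z $ 3"
  "grad (Sfun \<rho> t x u) Z $ 4 = - Z $ 4"
  by (auto simp: grad_def Sfun_def axis_def intro!: DERIV_imp_deriv derivative_eq_intros)

lemma vector_4:
  "(vector [a, b, c, d] :: 'a::zero^4) $ 1 = a"
  "(vector [a, b, c, d] :: 'a::zero^4) $ 2 = b"
  "(vector [a, b, c, d] :: 'a::zero^4) $ 3 = c"
  "(vector [a, b, c, d] :: 'a::zero^4) $ 4 = d"
  unfolding vector_def by simp_all

lemma M1_mult_nth:
  "(M1 *v z) $ 1 = - z $ 2" "(M1 *v z) $ 2 = z $ 1" "(M1 *v z) $ 3 = z $ 4" "(M1 *v z) $ 4 = - z $ 3"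
  by (simp_all add: matrix_vector_mult_def M1_def sum_4 vector_4)

lemma M2_mult_nth:
  "(M2 *v z) $ 1 = z $ 3" "(M2 *v z) $ 2 = - z $ 4" "(M2 *v z) $ 3 = - z $ 1" "(M2 *v z) $ 4 = z $ 2"
  by (simp_all add: matrix_vector_mult_def M2_def sum_4 vector_4)

lemma bounded_linear_Complex_nth: "bounded_linear (\<lambda>z :: real^'n. Complex (z $ i) (z $ j))"
  by (rule linear_conv_bounded_linear[THEN iffD1], rule linearI) (simp_all add: complex_eq_iff)

lemma norm_vec4_eq_Complex:
  fixes z :: "real^4"
  shows "(norm (Complex (z $ 1) (z $ 2)))\<^sup>2 + (norm (Complex (z $ 4) (z $ 3)))\<^sup>2 = (norm z)\<^sup>2"
  by (simp add: norm_vec_def L2_set_def sum_4 cmod_power2 sum_nonneg)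

text \<open>No integrability is required, since \<open>integral\<close> takes the value 0 on
  functions that are not integrable.\<close>

lemma integral_nonneg':
  fixes f :: "'a::euclidean_space \<Rightarrow> real"
  assumes "\<And>x. f x \<ge> 0"
  shows "integral S f \<ge> 0"
  using assms by (cases "f integrable_on S") (auto intro: integral_nonneg simp: not_integrable_integral)

lemma integrable_nonneg_not_eventually_ge_1:
  fixes f :: "real \<Rightarrow> real"
  assumes f: "f integrable_on UNIV" and nonneg: "\<And>s. f s \<ge> 0"
  shows "\<exists>s\<ge>S. f s \<le> 1"
proof (rule ccontr)
  assume "\<not> ?thesis"
  then have f1: "f s > 1" if "s \<ge> S" for s using that by force
  \<comment> \<open>An interval of length one more than the total integral: values above 1
    throughout it would exceed that total.\<close>
  define d where "d = integral UNIV f + 1"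
  have d: "d > 0" using integral_nonneg'[of f UNIV] nonneg by (simp add: d_def)
  have fi: "f integrable_on {S..S + d}" using integrable_on_subinterval[OF f] by simp
  have "integral {S..S + d} (\<lambda>s. 1) \<le> integral {S..S + d} f"
    by (rule integral_le[OF _ fi]) (use f1 in \<open>auto intro: less_imp_le\<close>)
  also have "\<dots> \<le> integral UNIV f"
    by (rule integral_subset_le[OF _ fi f]) (use nonneg in auto)
  finally show False using d by (simp add: d_def)
qed

text \<open>The lift of a closed curve gains a constant over one period, namely its winding. The
  constant disappears on differentiation, so the derivatives are periodic and hence bounded although
  the lift itself may not be.\<close>

lemma dD_quasi_periodic:
  assumes sm: "smooth h" and per: "\<And>t. h (t + T) = h t + c"
  shows "dD h (t + T) = dD h t"
proof -
  have d: "(h has_vector_derivative dD h t) (at t)" for t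
    using smooth_line_has_vector_derivative[OF sm, of 1 0 t] by (simp add: dD_smooth[OF sm])
  have "((\<lambda>t. h (t + T)) has_vector_derivative dD h (t + T)) (at t)"
    using smooth_line_has_vector_derivative[OF sm, of 1 T t] by (simp add: dD_smooth[OF sm])
  moreover have "((\<lambda>t. h (t + T)) has_vector_derivative dD h t) (at t)"
    unfolding per has_vector_derivative_add_const by (rule d)
  ultimately show ?thesis by (rule vector_derivative_unique_at)
qed

lemma funpow_dD_quasi_periodic_bounded:
  assumes T: "T > 0" and sm: "smooth h" and per: "\<And>t. h (t + T) = h t + c"
  shows "\<exists>K. \<forall>t. norm ((dD ^^ Suc i) h t) \<le> K"
proof (rule continuous_periodic_bounded[OF T smooth_continuous_on[OF smooth_funpow_dD[OF sm]]])
  show "(dD ^^ Suc i) h (t + T) = (dD ^^ Suc i) h t" for t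
  proof (induction i arbitrary: t)
    case 0
    then show ?case using dD_quasi_periodic[OF sm per] by simp
  next
    case (Suc i)
    then show ?case using dD_quasi_periodic[OF smooth_funpow_dD[OF sm, of "Suc i"], of T 0] by simp
  qed
qed

text \<open>A smooth periodic function has a bounded derivative and is globally Lipschitz. A bound
  on a compact set would not do, because the lifted phases range over the whole line.\<close>

lemma uniform_limit_periodic_comp:
  fixes \<psi> :: "real \<Rightarrow> 'b::real_normed_vector"
  assumes sm: "smooth \<psi>" and P: "P > 0" and per: "\<And>y. \<psi> (y + P) = \<psi> y"
    and u: "uniform_limit X \<theta> \<theta>1 F"
  shows "uniform_limit X (\<lambda>s z. \<psi> (\<theta> s z)) (\<lambda>z. \<psi> (\<theta>1 z)) F"
proof -
  obtain K where K: "\<And>t. norm (dD \<psi> t) \<le> K"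
    using funpow_dD_quasi_periodic_bounded[OF P sm, of 0 0] per by auto
  have lip: "norm (\<psi> a - \<psi> b) \<le> K * norm (a - b)" for a b
  proof (rule differentiable_bound[of UNIV])
    show "(\<psi> has_derivative (\<lambda>v. pd v \<psi> x)) (at x within UNIV)" for x
      using smooth_has_derivative[OF sm] by simp
    show "onorm (\<lambda>v. pd v \<psi> x) \<le> K" for x
    proof (rule onorm_le)
      show "norm (pd v \<psi> x) \<le> K * norm v" for v
        using pd_sum_Basis[OF sm, of v x] K[of x]
        by (simp add: dD_smooth[OF sm] mult.commute[of K] mult_left_mono)
    qed
  qed auto
  have K0: "K \<ge> 0" using K[of 0] norm_ge_zero order_trans by blast
  show ?thesis
  proof (rule uniform_limitI)
    fix e :: real assume e: "e > 0"
    then have "e / (K + 1) > 0" using K0 by simp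
    from uniform_limitD[OF u this]
    show "\<forall>\<^sub>F s in F. \<forall>z\<in>X. dist (\<psi> (\<theta> s z)) (\<psi> (\<theta>1 z)) < e"
    proof eventually_elim
      case (elim s)
      show ?case
      proof
        fix z assume "z \<in> X"
        then have d: "dist (\<theta> s z) (\<theta>1 z) < e / (K + 1)" using elim by blast
        have "dist (\<psi> (\<theta> s z)) (\<psi> (\<theta>1 z)) \<le> (K + 1) * dist (\<theta> s z) (\<theta>1 z)"
          using lip[of "\<theta> s z" "\<theta>1 z"] by (simp add: dist_norm distrib_right)
        also have "\<dots> < e" using d K0 by (simp add: pos_less_divide_eq mult.commute)
        finally show "dist (\<psi> (\<theta> s z)) (\<psi> (\<theta>1 z)) < e" .
      qed
    qed
  qed
qed

text \<open>The circle coordinate \<open>q\<close> is represented by a real lift, so periodicity in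
  \<open>t\<close> holds up to a winding number \<open>k\<close>. C-infinity convergence on the
  torus is expressed as uniform convergence of all mixed derivatives of periodic functions on the
  plane.\<close>

theorem theorem5p1:
  fixes T r :: real
    and V :: "real \<Rightarrow> real \<Rightarrow> real"
    and \<rho> :: "real \<Rightarrow> real"
    and u :: "real \<Rightarrow> real \<Rightarrow> real^2"
    and Z :: "real \<Rightarrow> real \<Rightarrow> real \<Rightarrow> real^4"
  assumes T_pos: "T > 0"
    and V_smooth: "smooth (\<lambda>(t, q). V t q)"
    and V_per_t: "\<forall>t q. V (t + T) q = V t q"
    and V_per_q: "\<forall>t q. V t (q + 2 * pi) = V t q"
    and V_bdd: "\<exists>C. \<forall>t q. \<bar>V t q\<bar> \<le> C"
    and rho_smooth: "smooth \<rho>"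
    and r_lt: "r < pi"
    and rho_supp: "\<forall>y. \<rho> y \<noteq> 0 \<longrightarrow> -r < y \<and> y < r"
    and u_smooth: "smooth (\<lambda>(s, t). u s t)"
    and u_per: "\<exists>k::int. \<forall>s t. u s (t + T) = u s t + vector [2 * pi * of_int k, 0]"
    and Z_smooth: "smooth (\<lambda>(s, t, x). Z s t x)"
    and Z_per_t: "\<forall>s t x. Z s (t + T) x = Z s t x"
    and Z_per_x: "\<forall>s t x. Z s t (x + 2 * pi) = Z s t x"
    and u_eq: "\<forall>s t. dD (\<lambda>s'. u s' t) s =
        - (Jmat *v dD (\<lambda>t'. u s t') t) + grad (Ham V \<rho> t (\<lambda>x. Z s t x $ 1)) (u s t)"
    and Z_eq: "\<forall>s t x. dD (\<lambda>s'. Z s' t x) s =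
        - (M1 *v dD (\<lambda>t'. Z s t' x) t) - (M2 *v dD (\<lambda>x'. Z s t x') x)
        + grad (Sfun \<rho> t x (u s t)) (Z s t x)"
    and finite_energy: "(\<lambda>s. integral {0..T} (\<lambda>t. (norm (dD (\<lambda>s'. u s' t) s))\<^sup>2)
        + integral (cbox (0, 0) (T, 2 * pi)) (\<lambda>(t, x). (norm (dD (\<lambda>s'. Z s' t x) s))\<^sup>2))
        integrable_on UNIV"
    and u_lim: "\<exists>up :: real \<Rightarrow> real^2. smooth up
        \<and> (\<exists>k::int. \<forall>t. up (t + T) = up t + vector [2 * pi * of_int k, 0])
        \<and> (\<forall>k. uniform_limit UNIV (\<lambda>s. (dD ^^ k) (u s)) ((dD ^^ k) up) at_top)"
    and du_lim: "\<forall>k. uniform_limit UNIV (\<lambda>s. (dD ^^ k) (\<lambda>t. dD (\<lambda>s'. u s' t) s)) (\<lambda>t. 0) at_top"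
    and irr: "irrationality_measure ((T / (2 * pi))\<^sup>2) = 2"
  shows "\<exists>Zp :: real \<Rightarrow> real \<Rightarrow> real^4. smooth (\<lambda>(t, x). Zp t x)
      \<and> (\<forall>t x. Zp (t + T) x = Zp t x) \<and> (\<forall>t x. Zp t (x + 2 * pi) = Zp t x)
      \<and> (\<forall>j k. uniform_limit UNIV (\<lambda>s (t, x). Dtx j k (Z s) t x) (\<lambda>(t, x). Dtx j k Zp t x) at_top)"
proof -
  define Zf where "Zf = (\<lambda>(s, t, x). Z s t x)"
  have Zf: "smooth Zf" using Z_smooth by (simp add: Zf_def)
  define Zs where "Zs s = (\<lambda>(t, x). Z s t x)" for s
  have Zs_Zf: "Zs s z = Zf (s, z)" for s z by (cases z) (simp add: Zs_def Zf_def)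
  have emb: "bounded_linear (\<lambda>z::real \<times> real. (0::real, z))"
    by (intro bounded_linear_Pair bounded_linear_zero bounded_linear_ident)
  have Zs_aff: "Zs s = (\<lambda>z. Zf ((0, z) + (s, 0)))" for s by (auto simp: Zs_Zf)
  have Zs_sm: "smooth (Zs s)" for s
    unfolding Zs_aff by (rule smooth_affine_comp[OF Zf bounded_linear_ident emb])
  have Zs_pd: "pd v (Zs s) z = pd (0, v) Zf (s, z)" for v s z
    unfolding Zs_aff pd_affine_comp[OF Zf bounded_linear_ident emb] by simp
  have Zs_per: "torus_periodic T (Zs s)" for s
    using Z_per_t Z_per_x by (simp add: torus_periodic_def Zs_def)
  \<comment> \<open>L1 and L2 turn M1 into multiplication by i, which halves the size of the system.\<close>
  define L1 L2 :: "real^4 \<Rightarrow> complex"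
    where "L1 z = Complex (z $ 1) (z $ 2)" and "L2 z = Complex (z $ 4) (z $ 3)" for z
  have L1: "bounded_linear L1" and L2: "bounded_linear L2"
    unfolding L1_def[abs_def] L2_def[abs_def] by (rule bounded_linear_Complex_nth)+
  have dZs: "dD (\<lambda>s'. Z s' t x) s = pd (1, 0) Zf (s, t, x)" for s t x
    using dD_line[OF Zf, of "(1, 0)" "(0, t, x)" s] by (simp add: Zf_def)
  have dZt: "dD (\<lambda>t'. Z s t' x) t = pd (1, 0) (Zs s) (t, x)" for s t x
    using dD_line[OF Zs_sm, of s "(1, 0)" "(0, x)" t] by (simp add: Zs_def)
  have dZx: "dD (\<lambda>x'. Z s t x') x = pd (0, 1) (Zs s) (t, x)" for s t x
    using dD_line[OF Zs_sm, of s "(0, 1)" "(t, 0)" x] by (simp add: Zs_def)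
  define q where "q s t = u s t $ 1" for s t
  define \<psi> where "\<psi> y = complex_of_real (rho_S1 \<rho> y)" for y
  define \<theta> where "\<theta> s z = q s (fst z) - snd z" for s and z :: "real \<times> real"
  define F where "F s z = \<psi> (\<theta> s z)" for s z
  have \<psi>_sm: "smooth \<psi>"
  proof -
    have "smooth (rho_S1 \<rho>)"
      by (rule smooth_rho_S1[OF r_lt _ rho_smooth]) (use rho_supp in force)
    from smooth_linear_comp[OF this bounded_linear_of_real] show ?thesis by (simp add: \<psi>_def[abs_def])
  qed
  have \<psi>_per: "\<psi> (y + 2 * pi) = \<psi> y" for y by (simp add: \<psi>_def rho_S1_periodic)
  interpret \<psi>: periodic_fun_simple \<psi> "2 * pi" by standard (rule \<psi>_per)
  have us_sm: "smooth (u s)" for s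
  proof -
    have "bounded_linear (\<lambda>t::real. (0::real, t))"
      by (intro bounded_linear_Pair bounded_linear_zero bounded_linear_ident)
    from smooth_affine_comp[OF u_smooth bounded_linear_ident this, of "(s, 0)"] show ?thesis by simp
  qed
  have q_sm: "smooth (q s)" for s
    unfolding q_def[abs_def] using smooth_linear_comp[OF us_sm bounded_linear_vec_nth] .
  have q_dD: "(dD ^^ k) (q s) t = (dD ^^ k) (u s) t $ 1" for k s t
    unfolding q_def[abs_def] using funpow_dD_linear_comp[OF us_sm bounded_linear_vec_nth] by metis
  have \<theta>_d: "(\<theta> s has_derivative (\<lambda>v. fst v * (dD ^^ 1) (q s) (fst z) + (- snd v))) (at z)" for s z
  proof -
    have "((\<lambda>z::real \<times> real. q s (fst z)) has_derivative (\<lambda>v. pd (fst v) (q s) (fst z))) (at z)"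
      by (rule has_derivative_compose[OF has_derivative_fst[OF has_derivative_ident] smooth_has_derivative[OF q_sm]])
    then have "(\<theta> s has_derivative (\<lambda>v. pd (fst v) (q s) (fst z) - snd v)) (at z)"
      unfolding \<theta>_def[abs_def] by (intro has_derivative_diff has_derivative_snd has_derivative_ident)
    moreover have "pd a (q s) y = a * (dD ^^ 1) (q s) y" for a y
      using pd_sum_Basis[OF q_sm, of a s y] by (simp add: dD_smooth[OF q_sm])
    ultimately show ?thesis by simp
  qed
  obtain up where up_sm: "smooth up" and up_per: "\<exists>k::int. \<forall>t. up (t + T) = up t + vector [2 * pi * of_int k, 0]"
    and up: "\<And>k. uniform_limit UNIV (\<lambda>s. (dD ^^ k) (u s)) ((dD ^^ k) up) at_top"
    using u_lim by blast
  \<comment> \<open>Derivatives of \<open>q\<close> of order at least one are eventually within 1 of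
    those of the limit curve, which are bounded by periodicity. Finitely many orders are involved
    for each \<open>k\<close>, so a common threshold \<open>S\<close> exists.\<close>
  have Fb: "\<exists>S::real. Ckb k {S..} F" for k
  proof -
    have "\<exists>K. \<forall>\<^sub>F s in at_top. \<forall>t. \<bar>(dD ^^ Suc i) (q s) t\<bar> \<le> K" for i
    proof -
      obtain K where K: "\<And>t. norm ((dD ^^ Suc i) up t) \<le> K"
        using up_per funpow_dD_quasi_periodic_bounded[OF T_pos up_sm] by blast
      have "\<forall>\<^sub>F s in at_top. \<forall>t. \<bar>(dD ^^ Suc i) (q s) t\<bar> \<le> K + 1"
        using uniform_limitD[OF up[of "Suc i"] zero_less_one]
      proof eventually_elim
        case (elim s)
        show ?case
        proof
          fix t
          have "norm ((dD ^^ Suc i) (u s) t) \<le> K + 1"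
            using elim K[of t] norm_triangle_sub[of "(dD ^^ Suc i) (u s) t" "(dD ^^ Suc i) up t"]
            by (auto simp del: funpow.simps simp: dist_norm dest!: spec[of _ t])
          then show "\<bar>(dD ^^ Suc i) (q s) t\<bar> \<le> K + 1"
            unfolding q_dD using component_le_norm_cart order_trans by blast
        qed
      qed
      then show ?thesis by blast
    qed
    then obtain K where K: "\<And>i. \<forall>\<^sub>F s in at_top. \<forall>t. \<bar>(dD ^^ Suc i) (q s) t\<bar> \<le> K i" by metis
    have "\<forall>\<^sub>F s in at_top. \<forall>i\<in>{..k}. \<forall>t. \<bar>(dD ^^ Suc i) (q s) t\<bar> \<le> K i"
      by (intro eventually_ball_finite ballI K) auto
    then obtain S where S: "\<And>s i t. s \<ge> S \<Longrightarrow> i \<le> k \<Longrightarrow> \<bar>(dD ^^ Suc i) (q s) t\<bar> \<le> K i"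
      unfolding eventually_at_top_linorder by (metis atMost_iff)
    have "Ckb k {S..} F" unfolding F_def[abs_def]
    proof (rule Ckb_periodic_comp[OF \<theta>_d _ \<psi>_sm _ \<psi>_per])
      show "Ckb k {S..} (\<lambda>s (z::real \<times> real). fst v * (dD ^^ 1) (q s) (fst z) + - snd v)" for v :: "real \<times> real"
      proof (rule Ckb_funpow_dD[OF q_sm])
        fix i :: nat assume "1 \<le> i" "i \<le> 1 + k"
        then obtain i' where "i = Suc i'" "i' \<le> k" by (cases i) auto
        then show "\<exists>K. \<forall>s\<in>{S..}. \<forall>t. \<bar>(dD ^^ i) (q s) t\<bar> \<le> K" using S by (metis atLeast_iff)
      qed
    qed simp
    then show ?thesis by blast
  qed
  have F_cont: "continuous_on UNIV (F s)" for s
  proof -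
    have "continuous_on UNIV (\<theta> s)"
      by (intro continuous_at_imp_continuous_on ballI has_derivative_continuous[OF \<theta>_d])
    then show ?thesis unfolding F_def[abs_def]
      by (intro continuous_on_compose2[OF smooth_continuous_on[OF \<psi>_sm]]) auto
  qed
  have F_per: "torus_periodic T (F s)" for s
  proof -
    obtain k :: int where k: "\<And>s t. u s (t + T) = u s t + vector [2 * pi * of_int k, 0]" using u_per by blast
    \<comment> \<open>The winding of the lift changes the phase by a multiple of 2 pi, which
      \<open>\<psi>\<close> does not see.\<close>
    have "F s (t + T, x) = F s (t, x)" for t x
    proof -
      have "\<theta> s (t + T, x) = \<theta> s (t, x) + of_int k * (2 * pi)" by (simp add: \<theta>_def q_def k)
      then show ?thesis by (simp only: F_def \<psi>.plus_of_int)
    qed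
    moreover have "F s (t, x + 2 * pi) = F s (t, x)" for t x
    proof -
      have "\<theta> s (t, x + 2 * pi) = \<theta> s (t, x) + of_int (- 1) * (2 * pi)" by (simp add: \<theta>_def)
      then show ?thesis by (simp only: F_def \<psi>.plus_of_int)
    qed
    ultimately show ?thesis by (simp add: torus_periodic_def)
  qed
  define F1 where "F1 z = \<psi> (up (fst z) $ 1 - snd z)" for z :: "real \<times> real"
  have F1_cont: "continuous_on UNIV F1"
    unfolding F1_def[abs_def]
    by (intro continuous_on_compose2[OF smooth_continuous_on[OF \<psi>_sm]] continuous_intros
        continuous_on_compose2[OF smooth_continuous_on[OF up_sm]]) auto
  have F_lim: "uniform_limit UNIV F F1 at_top"
    unfolding F_def[abs_def] F1_def[abs_def]
  proof (rule uniform_limit_periodic_comp[OF \<psi>_sm _ \<psi>_per])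
    show "uniform_limit UNIV \<theta> (\<lambda>z. up (fst z) $ 1 - snd z) at_top"
      unfolding uniform_limit_iff
    proof (intro allI impI)
      fix e :: real assume "e > 0"
      from uniform_limitD[OF up[of 0] this]
      show "\<forall>\<^sub>F s in at_top. \<forall>z\<in>UNIV. dist (\<theta> s z) (up (fst z) $ 1 - snd z) < e"
      proof eventually_elim
        case (elim s)
        have "dist (\<theta> s z) (up (fst z) $ 1 - snd z) < e" for z
        proof -
          have "dist (\<theta> s z) (up (fst z) $ 1 - snd z) = \<bar>(u s (fst z) - up (fst z)) $ 1\<bar>"
            by (simp add: \<theta>_def q_def dist_real_def)
          also have "\<dots> \<le> norm (u s (fst z) - up (fst z))" by (rule component_le_norm_cart)
          also have "\<dots> < e" using elim by (simp add: dist_norm)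
          finally show ?thesis .
        qed
        then show ?case by blast
      qed
    qed
  qed simp
  define A where "A s z = L1 (Zs s z)" for s z
  define C where "C s z = L2 (Zs s z)" for s z
  define A' where "A' s z = L1 (pd (1, 0) Zf (s, z))" for s z
  define C' where "C' s z = L2 (pd (1, 0) Zf (s, z))" for s z
  have A_sm: "smooth (A s)" and C_sm: "smooth (C s)" for s
    unfolding A_def[abs_def] C_def[abs_def] using smooth_linear_comp[OF Zs_sm] L1 L2 by blast+
  have A_per: "torus_periodic T (A s)" and C_per: "torus_periodic T (C s)" for s
    using Zs_per by (simp_all add: A_def C_def torus_periodic_def)
  have A_pd: "pd v (A s) z = L1 (pd v (Zs s) z)" and C_pd: "pd v (C s) z = L2 (pd v (Zs s) z)" for v s z
    unfolding A_def[abs_def] C_def[abs_def] by (simp_all add: pd_linear_comp[OF Zs_sm] L1 L2)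
  have line: "((\<lambda>s. Zs s z) has_vector_derivative pd (1, 0) Zf (s, z)) (at s)" for s z
    using smooth_line_has_vector_derivative[OF Zf, of "(1, 0)" "(0, z)" s] by (simp add: Zs_Zf)
  have A_d: "((\<lambda>s. A s z) has_vector_derivative A' s z) (at s)"
    and C_d: "((\<lambda>s. C s z) has_vector_derivative C' s z) (at s)" for s z
    unfolding A_def C_def A'_def C'_def
    using bounded_linear.has_vector_derivative[OF L1 line] bounded_linear.has_vector_derivative[OF L2 line] by blast+
  have cZ: "continuous_on UNIV (pd (1, 0) Zf)" by (rule smooth_continuous_on[OF smooth_pd[OF Zf]])
  have A'_c: "continuous_on UNIV (\<lambda>(s, z). A' s z)" and C'_c: "continuous_on UNIV (\<lambda>(s, z). C' s z)"
    using bounded_linear.continuous_on[OF L1 cZ] bounded_linear.continuous_on[OF L2 cZ]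
    by (simp_all add: A'_def C'_def case_prod_unfold)
  have Z_eq': "pd (1, 0) Zf (s, t, x) = - (M1 *v pd (1, 0) (Zs s) (t, x)) - (M2 *v pd (0, 1) (Zs s) (t, x))
      + grad (Sfun \<rho> t x (u s t)) (Zs s (t, x))" for s t x
    using Z_eq[rule_format, of t x s] unfolding dZs dZt dZx by (simp add: Zs_def)
  have A_eq: "A' s z = - \<i> * pd (1, 0) (A s) z + \<i> * pd (0, 1) (C s) z + A s z + F s z" for s z
    unfolding A_pd C_pd unfolding A'_def A_def F_def
    by (cases z) (simp add: Z_eq' L1_def L2_def \<psi>_def \<theta>_def q_def complex_eq_iff M1_mult_nth M2_mult_nth grad_Sfun)
  have C_eq: "C' s z = - \<i> * pd (1, 0) (C s) z + \<i> * pd (0, 1) (A s) z - C s z" for s z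
    unfolding A_pd C_pd unfolding C'_def C_def
    by (cases z) (simp add: Z_eq' L1_def L2_def complex_eq_iff M1_mult_nth M2_mult_nth grad_Sfun)
  \<comment> \<open>The contribution of \<open>u\<close> to the energy density is nonnegative, so a
    late time with total at most 1 also bounds the contribution of \<open>Z\<close>, which equals
    the integral of |A'|^2 + |C'|^2.\<close>
  have energy: "\<exists>s\<ge>S. integral (cbox (0, 0) (T, 2 * pi)) (\<lambda>z. (norm (A' s z))\<^sup>2 + (norm (C' s z))\<^sup>2) \<le> 1" for S
  proof -
    let ?u = "\<lambda>s. integral {0..T} (\<lambda>t. (norm (dD (\<lambda>s'. u s' t) s))\<^sup>2)"
    let ?Z = "\<lambda>s. integral (cbox (0, 0) (T, 2 * pi)) (\<lambda>(t, x). (norm (dD (\<lambda>s'. Z s' t x) s))\<^sup>2)"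
    have nonneg: "?u s \<ge> 0" "?Z s \<ge> 0" for s by (rule integral_nonneg'; auto)+
    have "?u s + ?Z s \<ge> 0" for s using nonneg[of s] by linarith
    from integrable_nonneg_not_eventually_ge_1[OF finite_energy this] obtain s where s: "s \<ge> S" "?u s + ?Z s \<le> 1" by blast
    have "integral (cbox (0, 0) (T, 2 * pi)) (\<lambda>z. (norm (A' s z))\<^sup>2 + (norm (C' s z))\<^sup>2) = ?Z s"
      unfolding A'_def C'_def L1_def L2_def norm_vec4_eq_Complex dZs by (simp add: case_prod_unfold)
    then show ?thesis using s nonneg[of s] by (intro exI[of _ s]) linarith
  qed
  note system = fcoef_coupled_system[OF T_pos irr A_sm A_per C_sm C_per A_d C_d A'_c C'_c A_eq C_eq F_cont F_per Fb F_lim F1_cont energy]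
  \<comment> \<open>The estimates for \<open>A\<close> and \<open>C\<close> recombine because the
    Euclidean norm in R^4 is at most the sum of the moduli of the two complex coordinates.\<close>
  have cauchy: "\<exists>S. \<forall>s\<ge>S. \<forall>s'\<ge>S. \<forall>z. dist (foldr pd w (Zs s) z) (foldr pd w (Zs s') z) < e" if "e > 0" for w e
  proof -
    have e2: "e / 2 > 0" using that by simp
    obtain S1 where S1: "\<And>s s' z. s \<ge> S1 \<Longrightarrow> s' \<ge> S1 \<Longrightarrow> norm (foldr pd w (A s) z - foldr pd w (A s') z) < e / 2"
      using torus_uniform_Cauchy[OF T_pos A_sm A_per system(1,3) e2] by blast
    obtain S2 where S2: "\<And>s s' z. s \<ge> S2 \<Longrightarrow> s' \<ge> S2 \<Longrightarrow> norm (foldr pd w (C s) z - foldr pd w (C s') z) < e / 2"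
      using torus_uniform_Cauchy[OF T_pos C_sm C_per system(2,4) e2] by blast
    have "dist (foldr pd w (Zs s) z) (foldr pd w (Zs s') z) < e" if "s \<ge> max S1 S2" "s' \<ge> max S1 S2" for s s' z
    proof -
      define v where "v = foldr pd w (Zs s) z - foldr pd w (Zs s') z"
      have "norm (L1 v) < e / 2"
        using S1[of s s' z] that unfolding A_def[abs_def] foldr_pd_linear_comp[OF Zs_sm L1] v_def
        by (simp add: linear_diff[OF bounded_linear.linear[OF L1]])
      moreover have "norm (L2 v) < e / 2"
        using S2[of s s' z] that unfolding C_def[abs_def] foldr_pd_linear_comp[OF Zs_sm L2] v_def
        by (simp add: linear_diff[OF bounded_linear.linear[OF L2]])
      moreover have "norm v \<le> norm (L1 v) + norm (L2 v)"
      proof (rule power2_le_imp_le)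
        show "(norm v)\<^sup>2 \<le> (norm (L1 v) + norm (L2 v))\<^sup>2"
          unfolding norm_vec4_eq_Complex[of v, symmetric] L1_def L2_def power2_sum by simp
      qed simp
      ultimately show ?thesis by (simp add: v_def dist_norm)
    qed
    then show ?thesis by blast
  qed
  obtain g where g_sm: "smooth g" and g: "\<And>w. uniform_limit UNIV (\<lambda>s. foldr pd w (Zs s)) (foldr pd w g) at_top"
    using smooth_uniform_limit[OF Zs_sm cauchy] by blast
  have g_lim: "((\<lambda>s. Zs s z) \<longlongrightarrow> g z) at_top" for z
    using tendsto_uniform_limitI[OF g[of "[]"], of z] by simp
  define Zp where "Zp t x = g (t, x)" for t x
  have gZp: "(\<lambda>(t, x). Zp t x) = g" by (auto simp: Zp_def)
  have "torus_periodic T g"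
  proof -
    have "g (t + T, x) = g (t, x)" for t x
      using tendsto_unique[OF trivial_limit_at_top_linorder g_lim[of "(t + T, x)"]] g_lim[of "(t, x)"] Zs_per
      unfolding torus_periodic_def by simp
    moreover have "g (t, x + 2 * pi) = g (t, x)" for t x
      using tendsto_unique[OF trivial_limit_at_top_linorder g_lim[of "(t, x + 2 * pi)"]] g_lim[of "(t, x)"] Zs_per
      unfolding torus_periodic_def by simp
    ultimately show ?thesis by (simp add: torus_periodic_def)
  qed
  moreover have "uniform_limit UNIV (\<lambda>s (t, x). Dtx j k (Z s) t x) (\<lambda>(t, x). Dtx j k Zp t x) at_top" for j k
  proof -
    let ?w = "replicate j (1, 0) @ replicate k (0, 1) :: (real \<times> real) list"
    have "(\<lambda>(t, x). Dtx j k (Z s) t x) = foldr pd ?w (Zs s)" for s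
      using Dtx_eq_foldr_pd[of "Z s" j k] Zs_sm[of s] unfolding Zs_def by (auto simp del: foldr_append)
    moreover have "(\<lambda>(t, x). Dtx j k Zp t x) = foldr pd ?w g"
      using Dtx_eq_foldr_pd[of Zp j k] g_sm unfolding gZp by (auto simp del: foldr_append)
    ultimately show ?thesis using g[of ?w] by simp
  qed
  ultimately show ?thesis
    using g_sm by (intro exI[of _ Zp]) (auto simp: gZp, auto simp: Zp_def torus_periodic_def)
qed

end
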